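(* Let $k,u\in\mathbb Z$ and $v,\ell,t,d_1,\dots,d_\ell\in\mathbb N$ with $2k=\ell+u$, $2t=d_1^2+\dots+d_\ell^2$ and $24v=u+3\ell$, so that $\phi(\tau,z)=\eta(\tau)^u\prod_{i=1}^\ell\vartheta(\tau,d_iz)\in J^{\mathrm{mero}}_{k,t}$. Let $\psi=(-1)^v\frac{\phi|V_2}{\phi}$, with Fourier coefficients $c(n,r;\psi)$, and let $D_0=\sum_{n\in\mathbb Z,\,n<0}\sigma_0(-n)c(n,0;\psi)$. Then $D_0\equiv1\pmod 2$ if and only if there exists an odd $\beta\in\mathbb N$ with $v=2^\beta$.
   Context: $q=e^{2\pi i\tau}$, $\zeta=e^{2\pi iz}$; $\eta(\tau)=q^{1/24}\prod_{n\ge1}(1-q^n)$, $\vartheta(\tau,z)=q^{1/8}(\zeta^{1/2}-\zeta^{-1/2})\prod_{j\ge1}(1-q^j\zeta)(1-q^j\zeta^{-1})(1-q^j)$. $J^{\mathrm{mero}}_{k,t}$ is the space of meromorphic functions on $\mathcal H_1\times\mathbb C$ satisfying the Jacobi transformation laws of weight $k$ and index $t$ for $\operatorname{SL}_2(\mathbb Z)\ltimes\mathbb Z^2$ with trivial character. $V_2$ is defined by $(\phi|V_2)(\tau,z)=2^{k-1}\phi(2\tau,2z)+\frac12(\phi(\frac\tau2,z)+\phi(\frac{\tau+1}2,z))$; $\psi$ is a weakly holomorphic Jacobi form of weight $0$ and index $t$ with Fourier expansion $\sum_{n,r\in\mathbb Z}c(n,r;\psi)q^n\zeta^r$, $n$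 bounded below. $\sigma_0(m)$ is the number of positive divisors of $m$. *)

theory Defs
  imports "HOL-Analysis.Analysis"
begin

definition qq :: "complex \<Rightarrow> complex" where
  "qq \<tau> = exp (2 * of_real pi * \<i> * \<tau>)"

definition eta :: "complex \<Rightarrow> complex" where
  "eta \<tau> = exp (2 * of_real pi * \<i> * \<tau> / 24) * prodinf (\<lambda>n. 1 - qq \<tau> ^ Suc n)"

definition jtheta :: "complex \<Rightarrow> complex \<Rightarrow> complex" where
  "jtheta \<tau> z = exp (2 * of_real pi * \<i> * \<tau> / 8)
     * (exp (of_real pi * \<i> * z) - exp (- (of_real pi * \<i> * z)))
     * prodinf (\<lambda>j. (1 - qq \<tau> ^ Suc j * qq z) * (1 - qq \<tau> ^ Suc j / qq z) * (1 - qq \<tau> ^ Suc j))"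

definition phi :: "int \<Rightarrow> nat \<Rightarrow> (nat \<Rightarrow> nat) \<Rightarrow> complex \<Rightarrow> complex \<Rightarrow> complex" where
  "phi u l d \<tau> z = eta \<tau> powi u * (\<Prod>i\<in>{1..l}. jtheta \<tau> (of_nat (d i) * z))"

definition V2 :: "int \<Rightarrow> (complex \<Rightarrow> complex \<Rightarrow> complex) \<Rightarrow> complex \<Rightarrow> complex \<Rightarrow> complex" where
  "V2 k f \<tau> z = (2::complex) powi (k - 1) * f (2 * \<tau>) (2 * z)
     + (1/2) * (f (\<tau> / 2) z + f ((\<tau> + 1) / 2) z)"

definition psi :: "int \<Rightarrow> int \<Rightarrow> nat \<Rightarrow> nat \<Rightarrow> (nat \<Rightarrow> nat) \<Rightarrow> complex \<Rightarrow> complex \<Rightarrow> complex" where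
  "psi k u v l d \<tau> z = (-1) ^ v * V2 k (phi u l d) \<tau> z / phi u l d \<tau> z"

text \<open>Fourier coefficient c(n,r) of a function on H x C, 1-periodic in tau and z, holomorphic,
  computed on the cycle Im tau = 1, Im z = 0.\<close>
definition fourier_coeff :: "(complex \<Rightarrow> complex \<Rightarrow> complex) \<Rightarrow> int \<Rightarrow> int \<Rightarrow> complex" where
  "fourier_coeff f n r = integral {0..1} (\<lambda>x::real. integral {0..1} (\<lambda>a::real.
       f (of_real x + \<i>) (of_real a)
       * exp (- 2 * of_real pi * \<i> * (of_int n * (of_real x + \<i>) + of_int r * of_real a))))"

definition sigma0 :: "nat \<Rightarrow> nat" where
  "sigma0 m = card {e. e dvd m}"

end

theory Submission
  imports Defs "HOL-Complex_Analysis.Complex_Analysis" "HOL-Library.Z2"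
begin

text \<open>For \<open>n < 0\<close> only the part \<open>(\<phi>(\<tau>/2,z) + \<phi>((\<tau>+1)/2,z))/2\<close> of \<open>\<phi>|V\<^sub>2\<close> contributes to \<open>c(n,0;\<psi>)\<close>.
  The coefficient of each power of \<open>q\<close> is an integer polynomial in \<open>\<zeta> + \<zeta>\<^sup>-\<^sup>1\<close>, and the \<open>\<zeta>\<^sup>0\<close> term of such a polynomial is
  congruent modulo 2 to its constant term because central binomial coefficients are even. Modulo 2 one may therefore put
  \<open>\<zeta> = 1\<close>, where \<open>\<phi>\<close> without its vanishing factors becomes \<open>\<Delta>\<^sup>v\<close> with \<open>\<Delta> = q \<Prod>(1-q\<^sup>n)\<^sup>2\<^sup>4\<close>. Writing \<open>U\<close> for the map
  \<open>\<Sum> a\<^sub>n q\<^sup>n \<mapsto> \<Sum> a\<^sub>2\<^sub>n q\<^sup>n\<close>, the parity of \<open>D\<^sub>0\<close> is that of the constant term of \<open>L U(\<Delta>\<^sup>v)/\<Delta>\<^sup>v\<close>, where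
  \<open>L = \<Sum> \<sigma>\<^sub>0(m) q\<^sup>m\<close>. Modulo 2, \<open>L\<close> is the sum of \<open>q\<^sup>m\<close> over the positive squares \<open>m\<close>, and \<open>\<Delta>\<close> is the sum over
  the odd squares (Gauss), so \<open>L = \<Delta> + L\<^sup>4\<close> and \<open>L\<close> is the sum of all \<open>\<Delta>\<close> to the power \<open>4\<^sup>j\<close>.
  For odd \<open>v\<close> one gets \<open>U(\<Delta>\<^sup>v) = 0\<close>; for \<open>v = 2w\<close> the quotient is \<open>\<Delta>\<^sup>-\<^sup>w\<close>, and a power of \<open>\<Delta>\<close>
  has nonzero constant term only if the exponent is zero, i.e. if \<open>w = 4\<^sup>j\<close>.\<close>

subsection \<open>Shanks' identity and formal infinite products\<close>

text \<open>Shanks' finite form of Gauss' formula. When \<open>n\<close> grows by one, the changes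
  of the summands with \<open>s < n\<close> telescope, and the boundary terms supply exactly the two
  new triangular powers. \<open>J\<close> plays the part of the inverses, so the identity holds in
  any commutative ring.\<close>

lemma Shanks_telescoping:
  fixes q :: "'a :: comm_ring_1" and J :: "nat \<Rightarrow> 'a"
  assumes J: "\<And>k. J k * (1 - q ^ (2 * k + 1)) = 1"
  defines "R \<equiv> \<lambda>n s. \<Prod>k\<in>{s..<n}. (1 - q ^ (2 * k + 2)) * J k"
  shows "(\<Sum>s<n. R n s * q ^ (s * (2 * n + 1))) = (\<Sum>m<2 * n. q ^ (m * (m + 1) div 2))"
proof (induction n)
  case (Suc n)
  \<comment> \<open>The telescoping certificate: passing from \<open>n\<close> to
    \<open>Suc n\<close> changes summand \<open>s\<close> by \<open>T (Suc s) - T s\<close>.\<close>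
  define T where "T = (\<lambda>s. R n s * q ^ (s * (2 * n + 1)) * (1 - q ^ (2 * s)) * J n)"
  have R1: "R (Suc n) s = R n s * ((1 - q ^ (2 * n + 2)) * J n)" if "s \<le> n" for s
    using that by (simp add: R_def)
  have step: "R (Suc n) s * q ^ (s * (2 * Suc n + 1)) - R n s * q ^ (s * (2 * n + 1)) = T (Suc s) - T s"
    if "s < n" for s
  proof -
    have e: "s * (2 * Suc n + 1) = s * (2 * n + 1) + 2 * s" by (simp add: algebra_simps)
    have R2: "R n s = (1 - q ^ (2 * s + 2)) * J s * R n (Suc s)"
      using that by (simp add: R_def prod.atLeast_Suc_lessThan)
    have "T (Suc s) = (J s * (1 - q ^ (2 * s + 1))) * R n (Suc s) * q ^ (s * (2 * n + 1)) * q ^ (2 * n + 1)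
            * (1 - q ^ (2 * s + 2)) * J n"
      unfolding J by (simp add: T_def algebra_simps power_add)
    also have "\<dots> = R n s * q ^ (s * (2 * n + 1)) * (q ^ (2 * n + 1) * (1 - q ^ (2 * s + 1)) * J n)"
      by (simp add: R2 algebra_simps)
    finally have "T (Suc s) - T s = R n s * q ^ (s * (2 * n + 1)) *
        ((1 - q ^ (2 * n + 2)) * J n * q ^ (2 * s) - J n * (1 - q ^ (2 * n + 1)))"
      by (simp add: T_def algebra_simps power_add)
    also have "\<dots> = R n s * q ^ (s * (2 * n + 1)) * ((1 - q ^ (2 * n + 2)) * J n * q ^ (2 * s) - 1)"
      unfolding J ..
    also have "\<dots> = R (Suc n) s * q ^ (s * (2 * Suc n + 1)) - R n s * q ^ (s * (2 * n + 1))"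
      unfolding R1[OF less_imp_le[OF that]] e power_add by (simp add: algebra_simps)
    finally show ?thesis ..
  qed
  have T: "T 0 = 0" "T n = q ^ (n * (2 * n + 1)) * (1 - q ^ (2 * n)) * J n"
    by (simp_all add: T_def R_def)
  have last: "R (Suc n) n = (1 - q ^ (2 * n + 2)) * J n"
    by (simp add: R_def)
  have tri: "2 * n * (2 * n + 1) div 2 = n * (2 * n + 1)" "(2 * n + 1) * (2 * n + 2) div 2 = n * (2 * n + 1) + (2 * n + 1)"
    by (simp_all add: algebra_simps)
  have "(\<Sum>s<Suc n. R (Suc n) s * q ^ (s * (2 * Suc n + 1)))
      = (\<Sum>s<n. R n s * q ^ (s * (2 * n + 1))) + (\<Sum>s<n. T (Suc s) - T s)
        + R (Suc n) n * q ^ (n * (2 * Suc n + 1))"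
    by (simp add: step[symmetric] flip: sum.distrib)
  also have "(\<Sum>s<n. T (Suc s) - T s) = T n - T 0"
    by (rule sum_lessThan_telescope)
  also have "T n - T 0 = q ^ (n * (2 * n + 1)) * (1 - q ^ (2 * n)) * J n"
    by (simp add: T)
  also have "R (Suc n) n * q ^ (n * (2 * Suc n + 1)) = (1 - q ^ (2 * n + 2)) * J n * q ^ (n * (2 * n + 1)) * q ^ (2 * n)"
  proof -
    have e: "n * (2 * Suc n + 1) = n * (2 * n + 1) + 2 * n" by (simp add: algebra_simps)
    show ?thesis unfolding last e power_add by (simp add: mult_ac)
  qed
  also have "(\<Sum>s<n. R n s * q ^ (s * (2 * n + 1))) + q ^ (n * (2 * n + 1)) * (1 - q ^ (2 * n)) * J n
      + (1 - q ^ (2 * n + 2)) * J n * q ^ (n * (2 * n + 1)) * q ^ (2 * n)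
      = (\<Sum>m<2 * n. q ^ (m * (m + 1) div 2)) + q ^ (n * (2 * n + 1)) * (1 + q ^ (2 * n + 1)) * (J n * (1 - q ^ (2 * n + 1)))"
  proof -
    \<comment> \<open>The exponents \<open>2 * n + 2\<close> and \<open>2 * n\<close> add up to
      twice \<open>2 * n + 1\<close>, so the boundary term and the new summand combine to a
      difference of squares, one factor of which cancels against \<open>J n\<close>.\<close>
    have "q ^ (2 * n + 2) * q ^ (2 * n) = q ^ (2 * n + 1) * q ^ (2 * n + 1)"
      by (simp flip: power_add add: mult_2)
    moreover have "A * (1 - B) * j + (1 - D) * j * A * B = A * (1 + C) * (j * (1 - C))"
      if "D * B = C * C" for A B C D j :: 'a
    proof -
      have "A * (1 - B) * j + (1 - D) * j * A * B = A * j * (1 - D * B)" by (simp add: algebra_simps)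
      thus ?thesis unfolding that by (simp add: algebra_simps)
    qed
    ultimately show ?thesis unfolding Suc.IH by (simp only: add.assoc)
  qed
  also have "\<dots> = (\<Sum>m<2 * n. q ^ (m * (m + 1) div 2)) + q ^ (2 * n * (2 * n + 1) div 2) + q ^ ((2 * n + 1) * (2 * n + 2) div 2)"
    by (simp only: J tri power_add[of q "n * (2 * n + 1)" "2 * n + 1"] distrib_left[where 'a = 'a]
        mult_1_right add.assoc)
  also have "\<dots> = (\<Sum>m<2 * Suc n. q ^ (m * (m + 1) div 2))"
    by simp
  finally show ?case .
qed simp

section \<open>Formal infinite products\<close>

definition fprod :: "(nat \<Rightarrow> 'a :: comm_ring_1 fps) \<Rightarrow> 'a fps" where
  "fprod f = Abs_fps (\<lambda>n. fps_nth (\<Prod>j<n. f j) n)"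

text \<open>If factor \<open>j\<close> is 1 up to degree \<open>j\<close>, then coefficient
  \<open>n\<close> of the partial products is stable from the \<open>n\<close>-th one on, which is
  what makes \<open>fprod\<close> meaningful.\<close>

definition fprod_convergent :: "(nat \<Rightarrow> 'a :: comm_ring_1 fps) \<Rightarrow> bool" where
  "fprod_convergent f \<longleftrightarrow> (\<forall>j. \<forall>i\<le>j. fps_nth (f j) i = fps_nth 1 i)"

lemma fps_mult_nth_cong:
  assumes "\<And>i. i \<le> n \<Longrightarrow> fps_nth f i = fps_nth f' i" "\<And>i. i \<le> n \<Longrightarrow> fps_nth g i = fps_nth g' i"
  shows "i \<le> n \<Longrightarrow> fps_nth (f * g) i = fps_nth (f' * g') i"
  using assms by (auto simp: fps_mult_nth intro!: sum.cong)

lemma fprod_nth: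
  assumes "fprod_convergent f" "n \<le> M"
  shows "fps_nth (fprod f) n = fps_nth (\<Prod>j<M. f j) n"
proof -
  have "fps_nth (\<Prod>j<M. f j) n = fps_nth (\<Prod>j<n. f j) n"
    using assms(2)
  proof (induction M rule: dec_induct)
    case (step M)
    have "fps_nth ((\<Prod>j<M. f j) * f M) n = fps_nth ((\<Prod>j<M. f j) * 1) n"
      by (rule fps_mult_nth_cong[where n = n])
         (use assms(1) step in \<open>auto simp: fprod_convergent_def\<close>)
    with step show ?case by simp
  qed auto
  thus ?thesis by (simp add: fprod_def)
qed

lemma fprod_nth_0: "fps_nth (fprod f) 0 = 1"
  by (simp add: fprod_def)

lemma fprod_convergent_mult:
  assumes "fprod_convergent f" "fprod_convergent g"
  shows "fprod_convergent (\<lambda>j. f j * g j)"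
  unfolding fprod_convergent_def
proof safe
  fix j i :: nat assume "i \<le> j"
  show "fps_nth (f j * g j) i = fps_nth 1 i"
    using fps_mult_nth_cong[of j "f j" 1 "g j" 1 i] assms \<open>i \<le> j\<close> by (auto simp: fprod_convergent_def)
qed

lemma fprod_mult:
  assumes "fprod_convergent f" "fprod_convergent g"
  shows "fprod (\<lambda>j. f j * g j) = fprod f * fprod g"
proof (rule fps_ext)
  fix n
  have "fps_nth (fprod f * fprod g) n = fps_nth ((\<Prod>j<n. f j) * (\<Prod>j<n. g j)) n"
    by (rule fps_mult_nth_cong[where n = n]) (auto simp: fprod_nth[OF assms(1)] fprod_nth[OF assms(2)])
  thus "fps_nth (fprod (\<lambda>j. f j * g j)) n = fps_nth (fprod f * fprod g) n"
    by (simp add: fprod_def prod.distrib)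
qed

lemma fprod_convergent_Euler: "fprod_convergent (\<lambda>j. 1 - fps_X ^ Suc j)"
  by (auto simp: fprod_convergent_def simp del: power_Suc)

subsection \<open>Power series modulo 2\<close>

lemma bit_add_self: "x + x = (0 :: bit)"
  by (cases x) auto

lemma bit_fps_add_self [simp]: "f + f = (0 :: bit fps)"
  by (simp add: fps_eq_iff)

lemma bit_fps_minus: "f - g = f + (g :: bit fps)"
  by (simp add: fps_eq_iff)

lemma bit_fps_square_add: "(f + g)\<^sup>2 = f\<^sup>2 + (g :: bit fps)\<^sup>2"
proof -
  have "(f + g)\<^sup>2 = f\<^sup>2 + g\<^sup>2 + (f * g + f * g)"
    by (simp add: power2_eq_square algebra_simps del: bit_fps_add_self)
  thus ?thesis by simp
qed

lemma bit_fps_square_one_minus: "(1 - f)\<^sup>2 = 1 - (f :: bit fps)\<^sup>2"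
  by (simp add: bit_fps_minus bit_fps_square_add)

lemma bit_mult_self: "x * x = (x :: bit)"
  by (cases x) auto

text \<open>The terms for \<open>i\<close> and \<open>n - i\<close> cancel in characteristic 2. Only
  the diagonal term remains, and elements of \<open>bit\<close> are idempotent.\<close>

lemma bit_fps_square_nth: "fps_nth ((f :: bit fps)\<^sup>2) n = (if even n then fps_nth f (n div 2) else 0)"
proof -
  define g where "g = (\<lambda>i. fps_nth f i * fps_nth f (n - i))"
  have "fps_nth (f\<^sup>2) n = (\<Sum>i\<in>{0..n}. g i)"
    by (simp add: power2_eq_square fps_mult_nth g_def)
  also have "{0..n} = {i. 2 * i < n} \<union> {i. i \<le> n \<and> n < 2 * i} \<union> {i. 2 * i = n}"
    by auto
  also have "(\<Sum>i\<in>\<dots>. g i) = (\<Sum>i\<in>{i. 2 * i < n}. g i) + (\<Sum>i\<in>{i. i \<le> n \<and> n < 2 * i}. g i) + (\<Sum>i\<in>{i. 2 * i = n}. g i)"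
    by (subst sum.union_disjoint; (subst sum.union_disjoint)?)
       (auto intro: finite_subset[of _ "{..n}"])
  also have "(\<Sum>i\<in>{i. i \<le> n \<and> n < 2 * i}. g i) = (\<Sum>i\<in>{i. 2 * i < n}. g i)"
    by (rule sum.reindex_bij_witness[of _ "\<lambda>i. n - i" "\<lambda>i. n - i"]) (auto simp: g_def mult.commute)
  also have "(\<Sum>i\<in>{i. 2 * i < n}. g i) + (\<Sum>i\<in>{i. 2 * i < n}. g i) = 0"
    by (rule bit_add_self)
  also have "{i. 2 * i = n} = (if even n then {n div 2} else {})"
    by auto
  finally have "fps_nth (f\<^sup>2) n = (if even n then g (n div 2) else 0)"
    by simp
  moreover have "g (n div 2) = fps_nth f (n div 2)" if "even n"
  proof -
    from that have "n - n div 2 = n div 2" by auto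
    thus ?thesis by (simp only: g_def bit_mult_self)
  qed
  ultimately show ?thesis by simp
qed

lemma bit_fps_pow2_nth:
  "fps_nth ((f :: bit fps) ^ (2 ^ k)) n = (if 2 ^ k dvd n then fps_nth f (n div 2 ^ k) else 0)"
proof (induction k arbitrary: n)
  case (Suc k)
  have "f ^ (2 ^ Suc k) = (f ^ (2 ^ k))\<^sup>2"
    by (simp add: power_mult [symmetric] mult.commute)
  hence "fps_nth (f ^ (2 ^ Suc k)) n = (if even n then fps_nth (f ^ (2 ^ k)) (n div 2) else 0)"
    by (simp only: bit_fps_square_nth)
  also have "\<dots> = (if 2 ^ Suc k dvd n then fps_nth f (n div 2 ^ Suc k) else 0)"
    unfolding Suc by (auto elim!: evenE dest: dvd_mult_left simp: div_mult2_eq)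
  finally show ?case .
qed simp

lemma bit_fps_pow8_nth:
  "fps_nth ((f :: bit fps) ^ 8) n = (if 8 dvd n then fps_nth f (n div 8) else 0)"
  using bit_fps_pow2_nth[of f 3 n] by simp

lemma bit_fps_pow4_nth:
  "fps_nth ((f :: bit fps) ^ 4) n = (if 4 dvd n then fps_nth f (n div 4) else 0)"
  using bit_fps_pow2_nth[of f 2 n] by simp

section \<open>Euler's product and the triangular-number series modulo 2\<close>

definition euler2 :: "bit fps" where
  "euler2 = fprod (\<lambda>j. 1 - fps_X ^ Suc j)"

definition theta2 :: "bit fps" where
  "theta2 = Abs_fps (\<lambda>n. if \<exists>m. n = m * (m + 1) div 2 then 1 else 0)"

lemma euler2_nth: "n \<le> M \<Longrightarrow> fps_nth euler2 n = fps_nth (\<Prod>j<M. 1 - fps_X ^ Suc j) n"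
  unfolding euler2_def by (rule fprod_nth[OF fprod_convergent_Euler])

lemma euler2_nth_0 [simp]: "fps_nth euler2 0 = 1"
  by (simp add: euler2_def fprod_nth_0)

lemma euler2_nonzero: "euler2 \<noteq> 0"
  by (metis euler2_nth_0 fps_zero_nth zero_neq_one)

lemma triangular_strict_mono: "strict_mono (\<lambda>m::nat. m * (m + 1) div 2)"
  by (rule strict_mono_Suc_iff[THEN iffD2]) (auto simp: algebra_simps)

lemma triangular_ge: "m * (m + 1) div 2 \<ge> (m::nat)"
  using strict_mono_imp_increasing[OF triangular_strict_mono] by simp

text \<open>Triangular numbers are pairwise distinct, so the indicator series is a sum of monomials;
  the \<open>m\<close>-th one is at least \<open>m\<close>, so \<open>M\<close> terms settle all
  degrees below \<open>M\<close>.\<close>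

lemma theta2_nth:
  assumes "n < M"
  shows "fps_nth theta2 n = fps_nth (\<Sum>m<M. fps_X ^ (m * (m + 1) div 2)) n"
proof -
  have inj: "m = m'" if "m * (m + 1) div 2 = m' * (m' + 1) div 2" for m m' :: nat
    using strict_mono_eq[OF triangular_strict_mono, of m m'] that by simp
  have "fps_nth (\<Sum>m<M. fps_X ^ (m * (m + 1) div 2)) n
      = (\<Sum>m<M. if n = m * (m + 1) div 2 then 1 else (0 :: bit))"
    by (simp add: fps_sum_nth)
  also have "\<dots> = (if \<exists>m. n = m * (m + 1) div 2 then 1 else 0)"
  proof (cases "\<exists>m. n = m * (m + 1) div 2")
    case True
    then obtain m where m: "n = m * (m + 1) div 2" by (elim exE)
    have iff: "n = i * (i + 1) div 2 \<longleftrightarrow> m = i" for i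
      unfolding m using inj[of m i] by metis
    have "(\<Sum>i<M. if n = i * (i + 1) div 2 then 1 else (0 :: bit)) = (\<Sum>i<M. if m = i then 1 else 0)"
      unfolding iff ..
    also have "\<dots> = 1" using m assms triangular_ge[of m] by simp
    finally show ?thesis using True by simp
  qed auto
  finally show ?thesis by (simp add: theta2_def)
qed

text \<open>The limit of Shanks' identity is Gauss' formula
  \<open>\<Sum>X^(m(m+1)/2) = \<Prod>(1-X^(2k))/(1-X^(2k-1))\<close>, whose right-hand side is the cube of Euler's product modulo 2.\<close>

lemma theta2_eq: "theta2 = euler2 ^ 3"
proof -
  define X where "X = (fps_X :: bit fps)"
  define EN where "EN = (\<lambda>n. \<Prod>j<n. 1 - X ^ Suc j)"
  define J where "J = (\<lambda>k. inverse (1 - X ^ (2 * k + 1)))"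
  define R where "R = (\<lambda>n s. \<Prod>k\<in>{s..<n}. (1 - X ^ (2 * k + 2)) * J k)"
  have J: "J k * (1 - X ^ (2 * k + 1)) = 1" for k
    unfolding J_def by (rule inverse_mult_eq_1) (simp add: X_def)
  have shanks: "(\<Sum>s<n. R n s * X ^ (s * (2 * n + 1))) = (\<Sum>m<2 * n. X ^ (m * (m + 1) div 2))" for n
    unfolding R_def by (rule Shanks_telescoping[OF J])
  have EN_split: "EN (2 * n) = (\<Prod>k<n. 1 - X ^ (2 * k + 1)) * (\<Prod>k<n. 1 - X ^ (2 * k + 2))" for n
    by (induction n) (simp_all add: EN_def)
  \<comment> \<open>By Frobenius the even-indexed factors of Euler's product form its
    square.\<close>
  have EN_sq: "(\<Prod>k<n. 1 - X ^ (2 * k + 2)) = EN n ^ 2" for n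
  proof -
    have "(X ^ Suc k)\<^sup>2 = X ^ (2 * k + 2)" for k 
      unfolding power_mult [symmetric] by (rule arg_cong[of _ _ "\<lambda>k. X ^ k"]) simp
    thus ?thesis by (simp only: EN_def prod_power_distrib bit_fps_square_one_minus)
  qed
  \<comment> \<open>Multiplying by the first \<open>2 * n\<close> Euler factors clears the
    denominators \<open>J\<close> in \<open>R n 0\<close>.\<close>
  have RE: "R n 0 * EN (2 * n) = EN n ^ 4" for n
  proof -
    have "R n 0 * EN (2 * n) = (\<Prod>k<n. J k * (1 - X ^ (2 * k + 1))) * ((\<Prod>k<n. 1 - X ^ (2 * k + 2)) * (\<Prod>k<n. 1 - X ^ (2 * k + 2)))"
      unfolding R_def EN_split by (simp add: prod.distrib lessThan_atLeast0 mult_ac)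
    also have "\<dots> = EN n ^ 4"
      unfolding J EN_sq by (simp flip: power_add)
    finally show ?thesis .
  qed
  \<comment> \<open>Only \<open>s = 0\<close> survives in Shanks' sum: every other summand is
    divisible by \<open>X ^ (2 * n + 1)\<close>. The condition \<open>n > 0\<close> guarantees
    \<open>i < 2 * n\<close>.\<close>
  have theta: "fps_nth theta2 i = fps_nth (R n 0) i" if "i \<le> n" "n > 0" for i n
  proof -
    obtain m where m: "n = Suc m" using \<open>n > 0\<close> by (cases n) auto
    have "fps_nth theta2 i = fps_nth (\<Sum>m<2 * n. X ^ (m * (m + 1) div 2)) i"
      unfolding X_def by (rule theta2_nth) (use that in auto)
    also have "\<dots> = fps_nth (\<Sum>s<n. R n s * X ^ (s * (2 * n + 1))) i"
      unfolding shanks ..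
    also have "\<dots> = fps_nth (R n 0) i + (\<Sum>s<m. fps_nth (R n (Suc s) * X ^ (Suc s * (2 * n + 1))) i)"
      unfolding m sum.lessThan_Suc_shift by (simp add: fps_sum_nth)
    also have "(\<Sum>s<m. fps_nth (R n (Suc s) * X ^ (Suc s * (2 * n + 1))) i) = 0"
    proof (intro sum.neutral ballI)
      fix s
      have "i < Suc s * (2 * n + 1)" using that by simp
      thus "fps_nth (R n (Suc s) * X ^ (Suc s * (2 * n + 1))) i = 0"
        unfolding X_def fps_X_power_mult_right_nth by simp
    qed
    finally show ?thesis by simp
  qed
  have "theta2 * euler2 = euler2 ^ 4"
  proof (rule fps_ext)
    fix n
    define N where "N = Suc n"
    have E: "fps_nth euler2 i = fps_nth (EN N) i" "fps_nth euler2 i = fps_nth (EN (2 * N)) i" if "i \<le> n" for i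
      using that euler2_nth[of i N] euler2_nth[of i "2 * N"] by (auto simp: EN_def X_def N_def)
    have Epow: "fps_nth (euler2 ^ k) i = fps_nth (EN N ^ k) i" if "i \<le> n" for i k
      using that
    proof (induction k arbitrary: i)
      case (Suc k)
      show ?case unfolding power_Suc
        by (rule fps_mult_nth_cong[where n = n]) (use Suc E in auto)
    qed auto
    have "fps_nth (theta2 * euler2) n = fps_nth (R N 0 * EN (2 * N)) n"
      by (rule fps_mult_nth_cong[where n = n]) (use E theta[of _ N] in \<open>auto simp: N_def\<close>)
    also have "\<dots> = fps_nth (euler2 ^ 4) n"
      unfolding RE by (simp add: Epow)
    finally show "fps_nth (theta2 * euler2) n = fps_nth (euler2 ^ 4) n" .
  qed
  also have "euler2 ^ 4 = euler2 ^ 3 * euler2" by (simp add: power_numeral_reduce mult_ac)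
  finally show ?thesis using euler2_nonzero by simp
qed

definition delta2 :: "bit fps" where
  "delta2 = fps_X * euler2 ^ 24"

lemma delta2_theta2: "delta2 = fps_X * theta2 ^ 8"
  by (simp add: delta2_def theta2_eq power_mult [symmetric])

text \<open>Modulo 2 the eighth power of \<open>theta2\<close> is its value at \<open>X ^ 8\<close>,
  and eight times the \<open>m\<close>-th triangular number plus one is the odd square
  \<open>(2 * m + 1)\<^sup>2\<close>.\<close>

lemma delta2_nth: "fps_nth delta2 n = (if odd n \<and> (\<exists>m. n = m\<^sup>2) then 1 else 0)"
proof -
  have "fps_nth delta2 n = (if n \<noteq> 0 \<and> 8 dvd n - 1 \<and> (\<exists>m. (n - 1) div 8 = m * (m + 1) div 2) then 1 else 0)"
    by (simp add: delta2_theta2 bit_fps_pow8_nth theta2_def)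
  also have "(n \<noteq> 0 \<and> 8 dvd n - 1 \<and> (\<exists>m. (n - 1) div 8 = m * (m + 1) div 2)) \<longleftrightarrow> odd n \<and> (\<exists>m. n = m\<^sup>2)"
  proof -
    have tri: "8 * (m * (m + 1) div 2) = 4 * (m * (m + 1))" for m :: nat
    proof -
      have "2 * (m * (m + 1) div 2) = m * (m + 1)" by (rule dvd_mult_div_cancel) simp
      thus ?thesis by linarith
    qed
    show ?thesis
    proof safe
      fix m assume *: "0 < n" "8 dvd n - 1" "(n - 1) div 8 = m * (m + 1) div 2"
      
      have "n - 1 = 8 * ((n - 1) div 8)" using *(2) by simp
      hence "n - 1 = 4 * (m * (m + 1))" unfolding *(3) tri .
      with * have n: "n = (2 * m + 1)\<^sup>2" by (simp add: power2_eq_square algebra_simps)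
      thus "\<exists>m. n = m\<^sup>2" by blast
      show "even n \<Longrightarrow> False" using n by simp
    next
      fix m :: nat assume "odd (m\<^sup>2)"
      then obtain j where j: "m = 2 * j + 1" by (auto elim: oddE)
      have eq: "m\<^sup>2 - 1 = 8 * (j * (j + 1) div 2)"
        unfolding tri j by (simp add: power2_eq_square algebra_simps)
      show "8 dvd m\<^sup>2 - 1" unfolding eq by simp
      show "\<exists>j. (m\<^sup>2 - 1) div 8 = j * (j + 1) div 2" unfolding eq by (intro exI[of _ j]) simp
    qed (auto intro!: Nat.gr0I)
  qed
  finally show ?thesis .
qed

subsection \<open>The parity of the principal part\<close>

definition fps_even_part :: "'a :: zero fps \<Rightarrow> 'a fps" where
  "fps_even_part f = Abs_fps (\<lambda>n. fps_nth f (2 * n))"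

lemma fps_even_part_square: "fps_even_part ((f :: bit fps)\<^sup>2) = f"
  by (simp add: fps_eq_iff fps_even_part_def bit_fps_square_nth)

text \<open>The involution sending \<open>e\<close> to \<open>n div e\<close> pairs off all divisors
  except a square root of \<open>n\<close>. For \<open>n = 0\<close> the set of divisors is
  infinite, so its \<open>card\<close> is 0.\<close>

lemma sigma0_bit: "(of_nat (sigma0 n) :: bit) = (if n > 0 \<and> (\<exists>m. n = m\<^sup>2) then 1 else 0)"
proof (cases "n = 0")
  case False
  hence fin: "finite {e. e dvd n}" by simp
  have "of_nat (sigma0 n) = (\<Sum>e\<in>{e. e dvd n}. 1 :: bit)"
    by (simp add: sigma0_def)
  also have "{e. e dvd n} = {e. e dvd n \<and> e * e < n} \<union> {e. e dvd n \<and> n < e * e} \<union> {e. e dvd n \<and> e * e = n}"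
    by auto
  also have "(\<Sum>e\<in>\<dots>. 1 :: bit) = (\<Sum>e\<in>{e. e dvd n \<and> e * e < n}. 1) + (\<Sum>e\<in>{e. e dvd n \<and> n < e * e}. 1)
      + (\<Sum>e\<in>{e. e dvd n \<and> e * e = n}. 1)"
    by (subst sum.union_disjoint; (subst sum.union_disjoint)?)
       (auto intro: finite_subset[OF _ fin])
  also have "(\<Sum>e\<in>{e. e dvd n \<and> n < e * e}. 1 :: bit) = (\<Sum>e\<in>{e. e dvd n \<and> e * e < n}. 1)"
  proof -
    have div: "n div (n div e) = e" "n div e dvd n" "n div e * (n div e) < n \<longleftrightarrow> n < e * e"
        "n < n div e * (n div e) \<longleftrightarrow> e * e < n" if e: "e dvd n" for e
    proof -
      from e obtain k where k: "n = e * k" by (elim dvdE)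
      with False have "e > 0" "k > 0" by auto
      thus "n div (n div e) = e" "n div e dvd n" "n div e * (n div e) < n \<longleftrightarrow> n < e * e"
        "n < n div e * (n div e) \<longleftrightarrow> e * e < n" by (auto simp: k)
    qed
    show ?thesis
      by (rule sum.reindex_bij_witness[of _ "\<lambda>e. n div e" "\<lambda>e. n div e"]) (simp_all add: div)
  qed
  also have "(\<Sum>e\<in>{e. e dvd n \<and> e * e < n}. 1 :: bit) + (\<Sum>e\<in>{e. e dvd n \<and> e * e < n}. 1) = 0"
    by (rule bit_add_self)
  also have "(\<Sum>e\<in>{e. e dvd n \<and> e * e = n}. 1 :: bit) = (if \<exists>m. n = m\<^sup>2 then 1 else 0)"
  proof (cases "\<exists>m. n = m\<^sup>2")
    case True
    then obtain m where m: "n = m * m" by (auto simp: power2_eq_square)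
    have "x = m" if "x * x = m * m" for x :: nat
      using that by (simp flip: power2_eq_square)
    hence "{e. e dvd n \<and> e * e = n} = {m}" by (auto simp: m)
    with True show ?thesis by simp
  next
    case False
    hence e: "{e. e dvd n \<and> e * e = n} = {}" by (auto simp: power2_eq_square)
    show ?thesis unfolding e using False by simp
  qed
  finally show ?thesis using False by auto
qed (simp add: sigma0_def)

definition divisors2 :: "bit fps" where
  "divisors2 = Abs_fps (\<lambda>n. of_nat (sigma0 n))"

lemma divisors2_nth: "fps_nth divisors2 n = (if n > 0 \<and> (\<exists>m. n = m\<^sup>2) then 1 else 0)"
  by (simp add: divisors2_def sigma0_bit)

text \<open>Positive squares are either odd squares or four times a positive square, and the fourth
  power substitutes \<open>X ^ 4\<close> for \<open>X\<close> modulo 2.\<close>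

lemma divisors2_eq: "divisors2 = delta2 + divisors2 ^ 4"
proof (rule fps_ext)
  fix n :: nat
  \<comment> \<open>Inequality of truth values is exclusive or, which matches addition in
    \<open>bit\<close>.\<close>
  have "(n > 0 \<and> (\<exists>m. n = m\<^sup>2)) \<longleftrightarrow>
      (odd n \<and> (\<exists>m. n = m\<^sup>2)) \<noteq> (4 dvd n \<and> n div 4 > 0 \<and> (\<exists>m. n div 4 = m\<^sup>2))" (is "?l \<longleftrightarrow> ?r")
  proof (cases "odd n")
    case False
    have "?l \<longleftrightarrow> (4 dvd n \<and> n div 4 > 0 \<and> (\<exists>m. n div 4 = m\<^sup>2))"
    proof
      assume ?l
      then obtain m where m: "n = m\<^sup>2" "n > 0" by blast
      with False have "even m" by simp
      then obtain j where j: "m = 2 * j" by (elim evenE)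
      hence n: "n = 4 * j\<^sup>2" by (simp add: m power_mult_distrib)
      with \<open>n > 0\<close> have "4 dvd n" "n div 4 > 0" "n div 4 = j\<^sup>2" by auto
      thus "4 dvd n \<and> n div 4 > 0 \<and> (\<exists>m. n div 4 = m\<^sup>2)" by blast
    next
      assume *: "4 dvd n \<and> n div 4 > 0 \<and> (\<exists>m. n div 4 = m\<^sup>2)"
      then obtain m where m: "n div 4 = m\<^sup>2" by blast
      have "n = 4 * (n div 4)" using * by simp
      also have "\<dots> = (2 * m)\<^sup>2" unfolding m by (simp add: power_mult_distrib)
      finally have "n = (2 * m)\<^sup>2" .
      moreover have "n > 0" using * by auto
      ultimately show ?l by blast
    qed
    with False show ?thesis by blast
  next
    case True
    moreover have "\<not> 4 dvd n" using True by (metis dvd_trans even_numeral)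
    ultimately show ?thesis by (auto elim: oddE)
  qed
  thus "fps_nth divisors2 n = fps_nth (delta2 + divisors2 ^ 4) n"
    by (auto simp: divisors2_nth bit_fps_pow4_nth delta2_nth simp del: bit_not_zero_iff bit_not_one_iff)
qed

text \<open>This is X / Delta: the reciprocal of Delta is shifted by X to be a power series. The
  constant term of Delta^(-w) thus becomes coefficient \<open>w\<close> of
  \<open>invdelta2 ^ w\<close>.\<close>

definition invdelta2 :: "bit fps" where
  "invdelta2 = inverse (euler2 ^ 24)"

lemma invdelta2_pow8: "invdelta2 = (inverse (euler2 ^ 3)) ^ 8"
  by (simp add: invdelta2_def fps_inverse_power power_mult [symmetric])

lemma invdelta2_power_nth: "\<not> 8 dvd n \<Longrightarrow> fps_nth (invdelta2 ^ w) n = 0"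
  unfolding invdelta2_pow8 power_mult [symmetric] mult.commute[of 8 w]
  unfolding power_mult bit_fps_pow8_nth by simp

text \<open>An even \<open>w\<close> can be halved by Frobenius. For odd \<open>w\<close> the
  coefficient vanishes since the series is an eighth power, hence supported on multiples of
  8.\<close>

lemma invdelta2_power_diag: "w > 0 \<Longrightarrow> fps_nth (invdelta2 ^ w) w = 0"
proof (induction w rule: less_induct)
  case (less w)
  show ?case
  proof (cases "even w")
    case True
    then obtain w' where w: "w = 2 * w'" by (elim evenE)
    have "fps_nth (invdelta2 ^ w) w = fps_nth ((invdelta2 ^ w')\<^sup>2) w"
      by (simp add: w power_mult [symmetric] mult.commute)
    also have "\<dots> = 0"
      using less.IH[of w'] less.prems by (simp add: bit_fps_square_nth w)
    finally show ?thesis .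
  next
    case False
    hence "\<not> 8 dvd w" by (metis dvd_trans even_numeral)
    thus ?thesis by (rule invdelta2_power_nth)
  qed
qed

lemma delta2_mult_invdelta2: "delta2 * invdelta2 = fps_X"
proof -
  have "euler2 ^ 24 * invdelta2 = 1"
    unfolding invdelta2_def by (subst mult.commute, rule inverse_mult_eq_1) (simp add: fps_power_zeroth_eq_one)
  thus ?thesis by (simp add: delta2_def mult.assoc)
qed

text \<open>The constant term of L Delta^(-w), where L = Delta + L^4. The summand Delta contributes
  only for \<open>w = 1\<close>. If 4 divides \<open>w\<close>, the other summand is the fourth
  power of the case \<open>w div 4\<close>; otherwise it contributes nothing.\<close>

lemma divisors2_invdelta2_nth:
  "fps_nth (divisors2 * invdelta2 ^ w) w = (if \<exists>j. w = 4 ^ j then 1 else 0)"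
proof (induction w rule: less_induct)
  case (less w)
  show ?case
  proof (cases "w = 0")
    case True
    thus ?thesis by (simp add: divisors2_nth)
  next
    case False
    define f where "f = divisors2 ^ 4"
    have "fps_nth (divisors2 * invdelta2 ^ w) w
        = fps_nth (delta2 * invdelta2 ^ w) w + fps_nth (f * invdelta2 ^ w) w"
      by (subst divisors2_eq) (simp add: distrib_right f_def)
    also have "delta2 * invdelta2 ^ w = fps_X * invdelta2 ^ (w - 1)"
      using False delta2_mult_invdelta2 by (cases w) (simp_all flip: mult.assoc)
    also have "fps_nth \<dots> w = (if w = 1 then 1 else 0)"
      using False invdelta2_power_diag[of "w - 1"] by auto
    also have "fps_nth (f * invdelta2 ^ w) w = (if 4 dvd w \<and> (\<exists>j. w div 4 = 4 ^ j) then 1 else 0)"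
    proof (cases "4 dvd w")
      case True
      then obtain w' where w: "w = 4 * w'" by (elim dvdE)
      have "f * invdelta2 ^ w = (divisors2 * invdelta2 ^ w') ^ 4"
        by (simp add: f_def w power_mult_distrib power_mult [symmetric] mult.commute)
      moreover have "fps_nth (divisors2 * invdelta2 ^ w') w' = (if \<exists>j. w' = 4 ^ j then 1 else 0)"
        by (rule less.IH) (use w False in auto)
      ultimately show ?thesis by (simp add: bit_fps_pow4_nth w)
    next
      case no: False
      \<comment> \<open>\<open>f\<close> is supported on multiples of 4 and
        \<open>invdelta2 ^ w\<close> on multiples of 8, so a nonzero product would make
        \<open>w\<close> a multiple of 4.\<close>
      have "fps_nth f i * fps_nth (invdelta2 ^ w) (w - i) = 0" if "i \<le> w" for i
      proof (cases "4 dvd i")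
        case True
        with no that have "\<not> 4 dvd w - i" by (metis dvd_diffD)
        hence "\<not> 8 dvd w - i" using dvd_trans[of 4 8 "w - i"] by auto
        thus ?thesis using invdelta2_power_nth by simp
      qed (simp add: f_def bit_fps_pow4_nth)
      hence "fps_nth (f * invdelta2 ^ w) w = 0"
        unfolding fps_mult_nth by (intro sum.neutral) auto
      with no show ?thesis by simp
    qed
    finally have eq: "fps_nth (divisors2 * invdelta2 ^ w) w = (if w = 1 then 1 else 0)
        + (if 4 dvd w \<and> (\<exists>j. w div 4 = 4 ^ j) then 1 else 0)" .
    have "(\<exists>j. w = 4 ^ j) \<longleftrightarrow> w = 1 \<or> (4 dvd w \<and> (\<exists>j. w div 4 = 4 ^ j))"
    proof
      assume "\<exists>j. w = 4 ^ j"
      then obtain j where j: "w = 4 ^ j" by blast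
      show "w = 1 \<or> (4 dvd w \<and> (\<exists>j. w div 4 = 4 ^ j))"
        using j by (cases j) auto
    next
      assume "w = 1 \<or> (4 dvd w \<and> (\<exists>j. w div 4 = 4 ^ j))"
      thus "\<exists>j. w = 4 ^ j"
      proof
        assume "w = 1"
        thus ?thesis by (intro exI[of _ 0]) simp
      next
        assume "4 dvd w \<and> (\<exists>j. w div 4 = 4 ^ j)"
        then obtain j where j: "4 dvd w" "w div 4 = 4 ^ j" by blast
        have "w = 4 * (w div 4)" using j(1) by simp
        thus ?thesis unfolding j(2) by (intro exI[of _ "Suc j"]) simp
      qed
    qed
    moreover have "\<not> (w = 1 \<and> 4 dvd w)" by auto
    \<comment> \<open>The two cases exclude each other, so the disjunction is an exclusive or and
      agrees with the sum in \<open>bit\<close>.\<close>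
    ultimately have "(\<exists>j. w = 4 ^ j) \<longleftrightarrow> (w = 1) \<noteq> (4 dvd w \<and> (\<exists>j. w div 4 = 4 ^ j))"
      by blast
    thus ?thesis unfolding eq by (simp only: split: if_split) simp
  qed
qed

text \<open>All exponents in \<open>delta2 ^ v\<close> are congruent to \<open>v\<close> modulo
  8.\<close>

lemma delta2_power_nth_even:
  assumes "odd v" "even n"
  shows "fps_nth (delta2 ^ v) n = 0"
proof -
  have "delta2 ^ v = fps_X ^ v * (theta2 ^ v) ^ 8"
    by (simp add: delta2_theta2 power_mult_distrib power_mult [symmetric] mult.commute)
  moreover have "\<not> 8 dvd n - v" if "n \<ge> v"
  proof -
    have "odd (n - v)" using that assms by simp
    thus ?thesis by (metis dvd_trans even_numeral)
  qed
  ultimately show ?thesis by (simp add: fps_X_power_mult_nth bit_fps_pow8_nth)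
qed

text \<open>The series multiplying the divisor counts is U(Delta^v) / Delta^v shifted by X^v, so its
  degree \<open>v - m\<close> is degree \<open>-m\<close> of the quotient, and the sum is a
  coefficient of a Cauchy product.\<close>

lemma principal_part_parity:
  "(\<Sum>m=1..v. of_nat (sigma0 m) * fps_nth (fps_even_part (delta2 ^ v) * inverse (euler2 ^ (24 * v))) (v - m))
     = (if \<exists>\<beta>. odd \<beta> \<and> v = 2 ^ \<beta> then 1 else (0 :: bit))"
proof -
  define H where "H = fps_even_part (delta2 ^ v) * invdelta2 ^ v"
  have pw: "inverse (euler2 ^ (24 * v)) = invdelta2 ^ v"
    by (simp add: invdelta2_def fps_inverse_power power_mult)
  \<comment> \<open>The term \<open>m = 0\<close> may be added because \<open>sigma0 0\<close> is
    0.\<close>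
  have "(\<Sum>m=1..v. of_nat (sigma0 m) * fps_nth H (v - m)) = (\<Sum>m=0..v. of_nat (sigma0 m) * fps_nth H (v - m))"
    by (rule sum.mono_neutral_left) (auto simp: sigma0_bit)
  also have "\<dots> = fps_nth (divisors2 * H) v"
    by (simp add: fps_mult_nth divisors2_def)
  also have "\<dots> = (if \<exists>\<beta>. odd \<beta> \<and> v = 2 ^ \<beta> then 1 else 0)"
  proof (cases "even v")
    case False
    have "fps_even_part (delta2 ^ v) = 0"
      by (simp add: fps_eq_iff fps_even_part_def delta2_power_nth_even False)
    moreover have "\<not> (\<exists>\<beta>. odd \<beta> \<and> v = 2 ^ \<beta>)"
      using False by (auto elim: oddE)
    ultimately show ?thesis by (simp add: H_def)
  next
    case True
    then obtain w where w: "v = 2 * w" by (elim evenE)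
    have "fps_even_part (delta2 ^ v) = delta2 ^ w"
      using fps_even_part_square[of "delta2 ^ w"] by (simp add: w power_mult [symmetric] mult.commute)
    hence "H = (delta2 * invdelta2) ^ w * invdelta2 ^ w"
      unfolding H_def w mult_2[of w] by (simp add: power_add power_mult_distrib mult.assoc)
    hence eq: "divisors2 * H = fps_X ^ w * (divisors2 * invdelta2 ^ w)"
      unfolding delta2_mult_invdelta2 by (simp only: mult_ac)
    have "fps_nth (divisors2 * H) v = (if \<exists>j. w = 4 ^ j then 1 else 0)"
      unfolding eq fps_X_power_mult_nth using divisors2_invdelta2_nth[of w] by (simp add: w)
    also have "(\<exists>j. w = 4 ^ j) \<longleftrightarrow> (\<exists>\<beta>. odd \<beta> \<and> v = 2 ^ \<beta>)"
    proof safe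
      fix j assume "w = 4 ^ j"
      hence "v = 2 ^ (2 * j + 1)" by (simp add: w power_mult)
      thus "\<exists>\<beta>. odd \<beta> \<and> v = 2 ^ \<beta>" by (intro exI[of _ "2 * j + 1"]) simp
    next
      fix \<beta> :: nat assume "odd \<beta>" "v = 2 ^ \<beta>"
      then obtain j where "\<beta> = 2 * j + 1" by (elim oddE)
      with \<open>v = 2 ^ \<beta>\<close> have "w = 4 ^ j" by (simp add: w power_mult)
      thus "\<exists>j. w = 4 ^ j" by blast
    qed
    finally show ?thesis .
  qed
  finally show ?thesis by (simp only: H_def pw)
qed

subsection \<open>Coefficients modulo 2\<close>

lemma integral_exp_int:
  "((\<lambda>a. exp (2 * of_real pi * \<i> * of_int m * of_real a)) has_integral (if m = 0 then 1 else 0)) {0..1}"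
proof (cases "m = 0")
  case True
  thus ?thesis using has_integral_const_real[of "1 :: complex" 0 1] by simp
next
  case False
  define c where "c = 2 * of_real pi * \<i> * (of_int m :: complex)"
  have c: "c \<noteq> 0" using False by (simp add: c_def)
  have "((\<lambda>a. exp (c * of_real a)) has_integral (exp (c * of_real 1) / c - exp (c * of_real 0) / c)) {0..1}"
  proof (rule fundamental_theorem_of_calculus)
    fix x :: real
    have "((\<lambda>a. exp (c * a) / c) has_field_derivative exp (c * of_real x)) (at (of_real x))"
      using c by (auto intro!: derivative_eq_intros)
    thus "((\<lambda>a. exp (c * of_real a) / c) has_vector_derivative exp (c * of_real x)) (at x within {0..1})"
      by (rule has_vector_derivative_real_field)
  qed simp
  moreover have "exp c = 1"
    using exp_integer_2pi[of "of_int m"] by (simp add: c_def mult_ac)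
  ultimately show ?thesis using False by (simp add: c_def)
qed

definition two_cos :: "nat \<Rightarrow> real \<Rightarrow> complex" where
  "two_cos d a = of_real (2 * cos (2 * pi * (of_nat d * a)))"

lemma two_cos_exp:
  "two_cos d a = exp (2 * of_real pi * \<i> * (of_nat d * of_real a)) + exp (- (2 * of_real pi * \<i> * (of_nat d * of_real a)))"
proof -
  have "two_cos d a = 2 * cos (of_real (2 * pi * (of_nat d * a)))"
    by (simp only: two_cos_def of_real_mult of_real_numeral flip: cos_of_real)
  also have "\<dots> = exp (\<i> * of_real (2 * pi * (of_nat d * a))) + exp (- (\<i> * of_real (2 * pi * (of_nat d * a))))"
    by (simp add: cos_exp_eq)
  finally show ?thesis by (simp add: mult_ac)
qed

text \<open>Pascal's rule splits the central coefficient into two equal neighbours.\<close>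

lemma even_central_binomial: "n > 0 \<Longrightarrow> even ((2 * n) choose n)"
proof -
  assume "n > 0"
  then obtain m where n: "n = Suc m" by (cases n) auto
  have "(2 * n) choose n = Suc (2 * m + 1) choose Suc m" by (simp add: n)
  also have "\<dots> = (2 * m + 1 choose m) + (2 * m + 1 choose Suc m)" by (rule binomial_Suc_Suc)
  also have "(2 * m + 1 choose Suc m) = (2 * m + 1 choose m)"
    using binomial_symmetric[of m "2 * m + 1"] by simp
  finally show ?thesis by simp
qed

text \<open>Integration over a period extracts the term in which the powers of zeta cancel: a
  central binomial coefficient for even \<open>n\<close>, nothing for odd \<open>n\<close>.\<close>

lemma integral_two_cos_power:
  "\<exists>m::int. ((\<lambda>a. two_cos 1 a ^ n) has_integral of_int m) {0..1} \<and> (of_int m :: bit) = (if n = 0 then 1 else 0)"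
proof -
  have "two_cos 1 a ^ n = (\<Sum>k\<le>n. of_nat (n choose k) * exp (2 * of_real pi * \<i> * of_int (2 * int k - int n) * of_real a))" for a
  proof -
    have "two_cos 1 a ^ n = (\<Sum>k\<le>n. of_nat (n choose k) * exp (2 * of_real pi * \<i> * of_real a) ^ k
            * exp (- (2 * of_real pi * \<i> * of_real a)) ^ (n - k))"
      unfolding two_cos_exp by (simp add: binomial_ring)
    also have "\<dots> = (\<Sum>k\<le>n. of_nat (n choose k) * exp (2 * of_real pi * \<i> * of_int (2 * int k - int n) * of_real a))"
      by (intro sum.cong refl)
         (simp add: mult.assoc of_nat_diff algebra_simps flip: exp_of_nat_mult exp_add)
    finally show ?thesis .
  qed
  moreover have "((\<lambda>a. \<Sum>k\<le>n. of_nat (n choose k) * exp (2 * of_real pi * \<i> * of_int (2 * int k - int n) * of_real a))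
       has_integral (\<Sum>k\<le>n. of_nat (n choose k) * (if 2 * int k - int n = 0 then 1 else 0))) {0..1}"
    by (intro has_integral_sum has_integral_mult_right integral_exp_int) auto
  moreover have "(\<Sum>k\<le>n. of_nat (n choose k) * (if 2 * int k - int n = 0 then 1 else 0 :: complex))
      = of_int (if even n then int (n choose (n div 2)) else 0)"
  proof -
    have "(\<Sum>k\<le>n. of_nat (n choose k) * (if 2 * int k - int n = 0 then 1 else 0 :: complex))
        = (\<Sum>k\<in>{k. 2 * k = n}. of_nat (n choose k))"
      by (rule sum.mono_neutral_cong_right) auto
    also have "{k. 2 * k = n} = (if even n then {n div 2} else {})" by auto
    finally show ?thesis by simp
  qed
  moreover have "(of_int (if even n then int (n choose (n div 2)) else 0) :: bit) = (if n = 0 then 1 else 0)"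
    using even_central_binomial[of "n div 2"] by (auto elim!: evenE)
  ultimately show ?thesis by (intro exI[of _ "if even n then int (n choose (n div 2)) else 0"]) simp
qed

text \<open>Integer polynomials in \<open>2 cos 2\<pi>a\<close>, i.e. symmetric integer Laurent polynomials in \<open>\<zeta>\<close>,
  paired with the residue modulo 2 of their constant term.\<close>

inductive cos_poly :: "(real \<Rightarrow> complex) \<Rightarrow> bit \<Rightarrow> bool" where
  of_int: "cos_poly (\<lambda>_. of_int m) (of_int m)"
| cos: "cos_poly (\<lambda>a. two_cos 1 a) 0"
| add: "cos_poly f b \<Longrightarrow> cos_poly g c \<Longrightarrow> cos_poly (\<lambda>a. f a + g a) (b + c)"
| mult: "cos_poly f b \<Longrightarrow> cos_poly g c \<Longrightarrow> cos_poly (\<lambda>a. f a * g a) (b * c)"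

lemma cos_poly_0: "cos_poly (\<lambda>_. 0) 0"
  using cos_poly.of_int[of 0] by simp

lemma cos_poly_1: "cos_poly (\<lambda>_. 1) 1"
  using cos_poly.of_int[of 1] by simp

lemma cos_poly_uminus: "cos_poly f b \<Longrightarrow> cos_poly (\<lambda>a. - f a) (- b)"
proof -
  assume "cos_poly f b"
  hence "cos_poly (\<lambda>a. of_int (-1) * f a) (of_int (-1) * b)"
    by (intro cos_poly.mult cos_poly.of_int)
  moreover have "of_int (-1) * b = - b" by (cases b) auto
  ultimately show ?thesis by (simp only: of_int_minus of_int_1 mult_minus1)
qed

lemma cos_poly_sum:
  "(\<And>i. i \<in> A \<Longrightarrow> cos_poly (f i) (b i)) \<Longrightarrow> cos_poly (\<lambda>a. \<Sum>i\<in>A. f i a) (\<Sum>i\<in>A. b i)"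
proof (induction A rule: infinite_finite_induct)
  case (insert x A)
  show ?case unfolding sum.insert[OF insert(1,2)]
    by (intro cos_poly.add insert) auto
qed (auto intro: cos_poly_0)

text \<open>Chebyshev recursion, started from \<open>two_cos 0 = 2\<close>, which is 0 modulo
  2.\<close>

lemma cos_poly_two_cos: "cos_poly (\<lambda>a. two_cos d a) 0"
proof (induction d rule: induct_nat_012)
  case 0
  show ?case using cos_poly.of_int[of 2] by (simp add: two_cos_def)
next
  case 1
  show ?case using cos_poly.cos by simp
next
  case (ge2 d)
  have eq: "two_cos (Suc (Suc d)) a = two_cos 1 a * two_cos (Suc d) a + - two_cos d a" for a
    unfolding two_cos_exp by (simp add: algebra_simps flip: exp_add)
  show ?case unfolding eq
    using cos_poly.add[OF cos_poly.mult[OF cos_poly.cos ge2(2)] cos_poly_uminus[OF ge2(1)]] by simp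
qed

text \<open>The quantifier over \<open>n\<close> makes the property stable under multiplication by every \<open>cos_poly\<close> function.\<close>

lemma cos_poly_integral_aux:
  assumes "cos_poly f b"
    and "\<forall>n. \<exists>m::int. ((\<lambda>a. h a * two_cos 1 a ^ n) has_integral of_int m) {0..1} \<and> of_int m = (if n = 0 then c else 0)"
  shows "\<forall>n. \<exists>m::int. ((\<lambda>a. f a * h a * two_cos 1 a ^ n) has_integral of_int m) {0..1} \<and> of_int m = (if n = 0 then b * c else 0)"
  using assms
proof (induction arbitrary: h c rule: cos_poly.induct)
  case (of_int k)
  show ?case
  proof
    fix n
    obtain m :: int where "((\<lambda>a. h a * two_cos 1 a ^ n) has_integral of_int m) {0..1}"
      "of_int m = (if n = 0 then c else 0)"
      using of_int by blast
    thus "\<exists>m::int. ((\<lambda>a. of_int k * h a * two_cos 1 a ^ n) has_integral of_int m) {0..1} \<and> of_int m = (if n = 0 then of_int k * c else 0)"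
      using has_integral_mult_right[of "\<lambda>a. h a * two_cos 1 a ^ n" "of_int m" "{0..1}" "of_int k"]
      by (intro exI[of _ "k * m"]) (auto simp: mult_ac)
  qed
next
  \<comment> \<open>The extra cosine raises the exponent to \<open>Suc n\<close>, where the
    hypothesis on \<open>h\<close> already gives residue 0.\<close>
  case cos
  show ?case
  proof
    fix n
    obtain m :: int where "((\<lambda>a. h a * two_cos 1 a ^ Suc n) has_integral of_int m) {0..1}" "(of_int m :: bit) = 0"
      using cos[rule_format, of "Suc n"] by auto
    thus "\<exists>m::int. ((\<lambda>a. two_cos 1 a * h a * two_cos 1 a ^ n) has_integral of_int m) {0..1} \<and> of_int m = (if n = 0 then 0 * c else 0)"
      by (intro exI[of _ m]) (auto simp: mult_ac)
  qed
next
  case (add f b g b')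
  show ?case
  proof
    fix n
    obtain m :: int where m: "((\<lambda>a. f a * h a * two_cos 1 a ^ n) has_integral of_int m) {0..1}"
      "of_int m = (if n = 0 then b * c else 0)"
      using add.IH(1)[OF add.prems] by blast
    obtain m' :: int where m': "((\<lambda>a. g a * h a * two_cos 1 a ^ n) has_integral of_int m') {0..1}"
      "of_int m' = (if n = 0 then b' * c else 0)"
      using add.IH(2)[OF add.prems] by blast
    show "\<exists>m::int. ((\<lambda>a. (f a + g a) * h a * two_cos 1 a ^ n) has_integral of_int m) {0..1} \<and> of_int m = (if n = 0 then (b + b') * c else 0)"
      using has_integral_add[OF m(1) m'(1)] m(2) m'(2)
      by (intro exI[of _ "m + m'"]) (simp add: distrib_right)
  qed
next
  \<comment> \<open>\<open>h\<close> is arbitrary in the induction, so the hypothesis for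
    \<open>f\<close> applies to the product of \<open>g\<close> and \<open>h\<close>.\<close>
  case (mult f b g b')
  show ?case
    using mult.IH(1)[OF mult.IH(2)[OF mult.prems]] unfolding mult.assoc .
qed

lemma cos_poly_integral:
  assumes "cos_poly f b"
  obtains m :: int where "(f has_integral of_int m) {0..1}" "of_int m = b"
proof -
  have "\<forall>n. \<exists>m::int. ((\<lambda>a. 1 * two_cos 1 a ^ n) has_integral of_int m) {0..1} \<and> (of_int m :: bit) = (if n = 0 then 1 else 0)"
    unfolding mult_1_left using integral_two_cos_power by blast
  from cos_poly_integral_aux[OF assms this, rule_format, of 0] that show ?thesis by auto
qed

section \<open>Reduction modulo 2 of power series depending on zeta\<close>

definition fps_reduces :: "(real \<Rightarrow> complex fps) \<Rightarrow> bit fps \<Rightarrow> bool" where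
  "fps_reduces F B \<longleftrightarrow> (\<forall>n. cos_poly (\<lambda>a. fps_nth (F a) n) (fps_nth B n))"

lemma fps_reduces_X_power: "fps_reduces (\<lambda>_. fps_X ^ n) (fps_X ^ n)"
  by (auto simp: fps_reduces_def intro: cos_poly_0 cos_poly_1)

lemma fps_reduces_1: "fps_reduces (\<lambda>_. 1) 1"
  using fps_reduces_X_power[of 0] by simp

lemma fps_reduces_const: "cos_poly f b \<Longrightarrow> fps_reduces (\<lambda>a. fps_const (f a)) (fps_const b)"
  by (auto simp: fps_reduces_def intro: cos_poly_0)

lemma fps_reduces_add:
  "fps_reduces F B \<Longrightarrow> fps_reduces G C \<Longrightarrow> fps_reduces (\<lambda>a. F a + G a) (B + C)"
  unfolding fps_reduces_def fps_add_nth by (intro allI cos_poly.add) auto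

lemma fps_reduces_uminus: "fps_reduces F B \<Longrightarrow> fps_reduces (\<lambda>a. - F a) (- B)"
  using cos_poly_uminus by (auto simp: fps_reduces_def)

lemma fps_reduces_diff:
  "fps_reduces F B \<Longrightarrow> fps_reduces G C \<Longrightarrow> fps_reduces (\<lambda>a. F a - G a) (B - C)"
  using fps_reduces_add[OF _ fps_reduces_uminus, of F B G C] by (simp add: bit_fps_minus)

lemma fps_reduces_mult:
  "fps_reduces F B \<Longrightarrow> fps_reduces G C \<Longrightarrow> fps_reduces (\<lambda>a. F a * G a) (B * C)"
  unfolding fps_reduces_def fps_mult_nth by (intro allI cos_poly_sum cos_poly.mult) auto

lemma fps_reduces_power: "fps_reduces F B \<Longrightarrow> fps_reduces (\<lambda>a. F a ^ n) (B ^ n)"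
  by (induction n) (auto intro: fps_reduces_1 fps_reduces_mult)

lemma fps_reduces_prod:
  "(\<And>i. i \<in> A \<Longrightarrow> fps_reduces (F i) (B i)) \<Longrightarrow> fps_reduces (\<lambda>a. \<Prod>i\<in>A. F i a) (\<Prod>i\<in>A. B i)"
  by (induction A rule: infinite_finite_induct) (auto intro: fps_reduces_1 fps_reduces_mult)

lemma fps_reduces_fprod:
  assumes "\<And>j. fps_reduces (F j) (B j)"
  shows "fps_reduces (\<lambda>a. fprod (\<lambda>j. F j a)) (fprod B)"
  using fps_reduces_prod[of "{..<n}" F B for n] assms by (auto simp: fps_reduces_def fprod_def)

lemma fps_inverse_nth_rec:
  fixes f :: "'a :: field fps"
  assumes "fps_nth f 0 = 1" "n > 0"
  shows "fps_nth (inverse f) n = - (\<Sum>i=1..n. fps_nth f i * fps_nth (inverse f) (n - i))"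
proof -
  have "f * inverse f = 1"
    using inverse_mult_eq_1[of f] assms by (simp add: mult.commute)
  hence "(\<Sum>i=0..n. fps_nth f i * fps_nth (inverse f) (n - i)) = 0"
    using assms(2) by (simp flip: fps_mult_nth)
  thus ?thesis
    using assms by (subst (asm) sum.atLeast_Suc_atMost) (simp_all add: eq_neg_iff_add_eq_0)
qed

text \<open>With constant coefficient 1 the recursion for the inverse uses ring operations only, so
  no denominators arise and reduction commutes with inversion.\<close>

lemma fps_reduces_inverse:
  assumes "fps_reduces F B" "\<And>a. fps_nth (F a) 0 = 1" "fps_nth B 0 = 1"
  shows "fps_reduces (\<lambda>a. inverse (F a)) (inverse B)"
  unfolding fps_reduces_def
proof
  fix n
  show "cos_poly (\<lambda>a. fps_nth (inverse (F a)) n) (fps_nth (inverse B) n)"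
  proof (induction n rule: less_induct)
    case (less n)
    show ?case
    proof (cases "n = 0")
      case True
      thus ?thesis using cos_poly_1 assms by (simp add: fps_inverse_def)
    next
      case False
      hence "cos_poly (\<lambda>a. - (\<Sum>i=1..n. fps_nth (F a) i * fps_nth (inverse (F a)) (n - i)))
          (- (\<Sum>i=1..n. fps_nth B i * fps_nth (inverse B) (n - i)))"
        using assms(1) less by (intro cos_poly_uminus cos_poly_sum cos_poly.mult) (auto simp: fps_reduces_def)
      thus ?thesis
        using False assms by (simp only: fps_inverse_nth_rec[of _ n])
    qed
  qed
qed

lemma fps_reduces_even_part: "fps_reduces F B \<Longrightarrow> fps_reduces (\<lambda>a. fps_even_part (F a)) (fps_even_part B)"
  by (simp add: fps_reduces_def fps_even_part_def)

definition euler_fps :: "complex fps" where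
  "euler_fps = fprod (\<lambda>j. 1 - fps_X ^ Suc j)"

text \<open>The parameter stands for \<open>c = w + 1/w\<close>, with \<open>w\<close> a power of
  zeta; then \<open>(1 - y * w) * (1 - y / w)\<close> equals \<open>1 - c * y + y\<^sup>2\<close>,
  so the series depends on zeta only through \<open>c\<close>.\<close>

definition theta_fps :: "complex \<Rightarrow> complex fps" where
  "theta_fps c = fprod (\<lambda>j. (1 - fps_const c * fps_X ^ Suc j + (fps_X ^ Suc j)\<^sup>2) * (1 - fps_X ^ Suc j))"

lemma fps_reduces_euler: "fps_reduces (\<lambda>_. euler_fps) euler2"
  unfolding euler_fps_def euler2_def
  by (intro fps_reduces_fprod fps_reduces_diff fps_reduces_1 fps_reduces_X_power)

text \<open>The residue 0 of \<open>two_cos d\<close> is also its value 2 at zeta = 1. Modulo 2 the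
  quadratic factor becomes \<open>1 + y\<^sup>2\<close>, the square of \<open>1 - y\<close>, so each
  factor is a cube.\<close>

lemma fps_reduces_theta: "fps_reduces (\<lambda>a. theta_fps (two_cos d a)) (euler2 ^ 3)"
proof -
  define e :: "nat \<Rightarrow> bit fps" where "e = (\<lambda>j. 1 - fps_X ^ Suc j)"
  have "fps_reduces (\<lambda>a. theta_fps (two_cos d a))
     (fprod (\<lambda>j. (1 - fps_const 0 * fps_X ^ Suc j + (fps_X ^ Suc j)\<^sup>2) * (1 - fps_X ^ Suc j)))"
    unfolding theta_fps_def
    by (intro fps_reduces_fprod fps_reduces_diff fps_reduces_1 fps_reduces_X_power fps_reduces_mult
          fps_reduces_add fps_reduces_const cos_poly_two_cos fps_reduces_power)
  also have "(\<lambda>j. (1 - fps_const 0 * fps_X ^ Suc j + (fps_X ^ Suc j)\<^sup>2) * (1 - fps_X ^ Suc j)) = (\<lambda>j. e j * (e j * e j))"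
    using bit_fps_square_one_minus by (simp add: e_def bit_fps_minus power2_eq_square mult_ac)
  also have "fprod (\<lambda>j. e j * (e j * e j)) = fprod e * (fprod e * fprod e)"
    using fprod_convergent_Euler[where 'a = bit]
    by (simp only: e_def fprod_mult fprod_convergent_mult)
  also have "\<dots> = euler2 ^ 3"
    by (simp add: euler2_def e_def power3_eq_cube mult.assoc)
  finally show ?thesis .
qed

subsection \<open>Analytic products\<close>

text \<open>Factors are written \<open>1 + q\<^sup>j\<^sup>+\<^sup>1 r(c, q\<^sup>j\<^sup>+\<^sup>1)\<close> so that both Euler's product and the theta product are instances.\<close>

definition qprod :: "(complex \<Rightarrow> complex \<Rightarrow> complex) \<Rightarrow> complex \<Rightarrow> complex \<Rightarrow> complex" where
  "qprod r c q = prodinf (\<lambda>j. 1 + q ^ Suc j * r c (q ^ Suc j))"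

text \<open>\<open>r\<close> is bounded on the compact set \<open>K \<times> cball 0 1\<close>,
  which contains all arguments as \<open>norm q \<le> \<rho> < 1\<close>; the prefactor
  \<open>q ^ Suc j\<close> supplies geometric decay.\<close>

lemma qprod_bound:
  fixes r :: "complex \<Rightarrow> complex \<Rightarrow> complex"
  assumes "compact K" "continuous_on UNIV (\<lambda>(c, q). r c q)" "0 \<le> \<rho>" "\<rho> < 1"
  obtains M where "\<And>c q j. c \<in> K \<Longrightarrow> norm q \<le> \<rho> \<Longrightarrow> norm (q ^ Suc j * r c (q ^ Suc j)) \<le> M * \<rho> ^ j"
proof -
  have "compact ((\<lambda>(c, q). r c q) ` (K \<times> cball 0 1))"
    by (intro compact_continuous_image compact_Times compact_cball assms continuous_on_subset[OF assms(2)]) auto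
  then obtain M where M: "\<And>c q. c \<in> K \<Longrightarrow> norm q \<le> 1 \<Longrightarrow> norm (r c q) \<le> M"
    by (fastforce dest!: compact_imp_bounded simp: bounded_iff)
  show ?thesis
  proof (rule that)
    fix c q :: complex and j :: nat
    assume cq: "c \<in> K" "norm q \<le> \<rho>"
    have q1: "norm q ^ Suc j \<le> \<rho> ^ j"
    proof -
      have "norm q ^ Suc j \<le> \<rho> ^ Suc j" using cq by (intro power_mono) auto
      also have "\<dots> \<le> \<rho> ^ j" using assms by (simp add: mult_left_le_one_le)
      finally show ?thesis .
    qed
    have "norm (r c (q ^ Suc j)) \<le> M"
    proof (rule M[OF cq(1)])
      show "norm (q ^ Suc j) \<le> 1"
        unfolding norm_power using cq assms by (intro power_le_one) auto
    qed
    hence "norm (q ^ Suc j) * norm (r c (q ^ Suc j)) \<le> \<rho> ^ j * M"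
      using q1 assms by (intro mult_mono) (auto simp: norm_power simp del: power_Suc)
    thus "norm (q ^ Suc j * r c (q ^ Suc j)) \<le> M * \<rho> ^ j"
      by (simp only: norm_mult mult.commute)
  qed
qed

lemma qprod_convergent:
  fixes r :: "complex \<Rightarrow> complex \<Rightarrow> complex"
  assumes "continuous_on UNIV (\<lambda>(c, q). r c q)" "norm q < 1"
  shows "convergent_prod (\<lambda>j. 1 + q ^ Suc j * r c (q ^ Suc j))"
proof -
  obtain M where M: "\<And>j. norm (q ^ Suc j * r c (q ^ Suc j)) \<le> M * norm q ^ j"
    using qprod_bound[of "{c}" r "norm q"] assms by (metis compact_sing norm_ge_zero order_refl singletonI)
  have "summable (\<lambda>j. M * norm q ^ j)"
    using assms(2) by (intro summable_mult summable_geometric) auto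
  hence "summable (\<lambda>j. norm (1 + q ^ Suc j * r c (q ^ Suc j) - 1))"
  proof (rule summable_comparison_test'[where N = 0])
    fix j
    show "norm (norm (1 + q ^ Suc j * r c (q ^ Suc j) - 1)) \<le> M * norm q ^ j"
      using M[of j] by (simp only: add_diff_cancel_left' real_norm_def abs_norm_cancel)
  qed
  thus ?thesis
    by (intro abs_convergent_prod_imp_convergent_prod summable_imp_abs_convergent_prod)
qed

text \<open>Uniformity in \<open>c\<close> and \<open>q\<close> jointly yields joint continuity of
  the product, which the later exchange of integrals requires.\<close>

lemma qprod_uniform_limit:
  assumes "compact K" and r: "continuous_on UNIV (\<lambda>(c, q). r c q)" and "0 \<le> \<rho>" "\<rho> < 1"
  shows "uniform_limit (K \<times> cball 0 \<rho>) (\<lambda>N (c, q). \<Prod>j<N. 1 + q ^ Suc j * r c (q ^ Suc j))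
           (\<lambda>(c, q). qprod r c q) sequentially"
proof -
  define f where "f = (\<lambda>j (c, q). q ^ Suc j * r c (q ^ Suc j))"
  obtain M where M: "\<And>c q j. c \<in> K \<Longrightarrow> norm q \<le> \<rho> \<Longrightarrow> norm (q ^ Suc j * r c (q ^ Suc j)) \<le> M * \<rho> ^ j"
    using qprod_bound[OF assms] by blast
  have "uniformly_convergent_on (K \<times> cball 0 \<rho>) (\<lambda>N x. \<Prod>j<N. 1 + f j x)"
  proof (rule uniformly_convergent_on_prod)
    show "continuous_on (K \<times> cball 0 \<rho>) (f j)" for j
    proof -
      have "continuous_on (K \<times> cball (0 :: complex) \<rho>) (\<lambda>x. (\<lambda>(c, q). r c q) (fst x, snd x ^ Suc j))"
        by (rule continuous_on_compose2[OF r]) (auto intro!: continuous_intros)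
      thus ?thesis unfolding f_def case_prod_unfold by (intro continuous_intros) simp
    qed
    show "compact (K \<times> cball (0 :: complex) \<rho>)" by (intro compact_Times compact_cball assms)
    have "summable (\<lambda>j. M * \<rho> ^ j)"
      using assms by (intro summable_mult summable_geometric) auto
    thus "uniformly_convergent_on (K \<times> cball 0 \<rho>) (\<lambda>N x. \<Sum>j<N. norm (f j x))"
      by (intro Weierstrass_m_test'[where M = "\<lambda>j. M * \<rho> ^ j"]) (use M in \<open>auto simp: f_def\<close>)
  qed
  hence lim: "uniform_limit (K \<times> cball 0 \<rho>) (\<lambda>N x. \<Prod>j<N. 1 + f j x) (\<lambda>x. lim (\<lambda>N. \<Prod>j<N. 1 + f j x)) sequentially"
    by (simp add: uniformly_convergent_uniform_limit_iff)
  show ?thesis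
  proof (rule uniform_limit_cong'[THEN iffD1, OF _ _ lim])
    fix x assume x: "x \<in> K \<times> cball (0 :: complex) \<rho>"
    obtain c q where cq: "x = (c, q)" by (cases x)
    have "convergent_prod (\<lambda>j. 1 + f j x)"
      using qprod_convergent[OF r, of q c] x assms by (auto simp: f_def cq)
    hence "(\<lambda>N. \<Prod>j\<le>N. 1 + f j x) \<longlonglongrightarrow> prodinf (\<lambda>j. 1 + f j x)"
      by (rule convergent_prod_LIMSEQ)
    hence "(\<lambda>N. \<Prod>j<N. 1 + f j x) \<longlonglongrightarrow> prodinf (\<lambda>j. 1 + f j x)"
      unfolding lessThan_Suc_atMost[symmetric] by (rule LIMSEQ_imp_Suc)
    thus "lim (\<lambda>N. \<Prod>j<N. 1 + f j x) = (\<lambda>(c, q). qprod r c q) x"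
      by (intro limI) (simp add: qprod_def cq f_def)
  qed (auto simp: f_def)
qed

lemma continuous_on_qprod:
  assumes r: "continuous_on UNIV (\<lambda>(c, q). r c q)"
    and "continuous_on X c" "continuous_on X q" "compact K" "c ` X \<subseteq> K" "q ` X \<subseteq> cball 0 \<rho>" "0 \<le> \<rho>" "\<rho> < 1"
  shows "continuous_on X (\<lambda>x. qprod r (c x) (q x))"
proof -
  have fac: "continuous_on (K \<times> cball 0 \<rho>) (\<lambda>(c, q). \<Prod>j<N. 1 + q ^ Suc j * r c (q ^ Suc j))" for N
  proof -
    have "continuous_on (K \<times> cball 0 \<rho>) (\<lambda>x. (\<lambda>(c, q). r c q) (fst x, snd x ^ Suc j))" for j
      by (rule continuous_on_compose2[OF r]) (auto intro!: continuous_intros)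
    thus ?thesis unfolding case_prod_unfold by (intro continuous_intros) simp
  qed
  have "continuous_on (K \<times> cball 0 \<rho>) (\<lambda>(c, q). qprod r c q)"
    by (rule uniform_limit_theorem[OF _ qprod_uniform_limit])
       (use assms fac in \<open>auto intro: always_eventually\<close>)
  hence "continuous_on X (\<lambda>x. (\<lambda>(c, q). qprod r c q) (c x, q x))"
    by (rule continuous_on_compose2) (use assms in \<open>auto intro!: continuous_intros\<close>)
  thus ?thesis by simp
qed

lemma holomorphic_qprod:
  assumes r: "continuous_on UNIV (\<lambda>(c, q). r c q)" and hol: "r c holomorphic_on UNIV"
  shows "qprod r c holomorphic_on ball 0 1"
    and "uniform_limit (ball 0 (1/2)) (\<lambda>N q. \<Prod>j<N. 1 + q ^ Suc j * r c (q ^ Suc j)) (qprod r c) sequentially"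
    and "(\<lambda>q. 1 + q ^ Suc j * r c (q ^ Suc j)) holomorphic_on A"
proof -
  show fac: "(\<lambda>q. 1 + q ^ Suc j * r c (q ^ Suc j)) holomorphic_on A" for A j
  proof -
    have "(r c \<circ> (\<lambda>q. q ^ Suc j)) holomorphic_on A"
      by (rule holomorphic_on_compose_gen[OF _ hol]) (auto intro!: holomorphic_intros)
    thus ?thesis unfolding o_def by (intro holomorphic_intros)
  qed
  have ul: "uniform_limit (cball 0 \<rho>) (\<lambda>N q. \<Prod>j<N. 1 + q ^ Suc j * r c (q ^ Suc j)) (qprod r c) sequentially"
    if "0 \<le> \<rho>" "\<rho> < 1" for \<rho>
    using uniform_limit_compose'[OF qprod_uniform_limit[OF _ r that, of "{c}"], of "\<lambda>q. (c, q)" "cball 0 \<rho>"] by auto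
  show "qprod r c holomorphic_on ball 0 1"
  proof (rule holomorphic_uniform_sequence)
    show "(\<lambda>q. \<Prod>j<N. 1 + q ^ Suc j * r c (q ^ Suc j)) holomorphic_on ball 0 1" for N
      by (intro holomorphic_on_prod fac)
    fix x :: complex assume x: "x \<in> ball 0 1"
    \<comment> \<open>Half the distance to the unit circle keeps the closed disc around
      \<open>x\<close> inside a smaller concentric disc.\<close>
    define d where "d = (1 - norm x) / 2"
    have sub: "cball x d \<subseteq> cball 0 ((1 + norm x) / 2)"
    proof
      fix y assume "y \<in> cball x d"
      thus "y \<in> cball 0 ((1 + norm x) / 2)"
        using norm_triangle_ineq2[of y x] by (simp add: d_def dist_norm norm_minus_commute field_simps)
    qed
    have "uniform_limit (cball x d) (\<lambda>N q. \<Prod>j<N. 1 + q ^ Suc j * r c (q ^ Suc j)) (qprod r c) sequentially"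
      by (rule uniform_limit_on_subset[OF ul sub]) (use x in auto)
    moreover have "cball 0 ((1 + norm x) / 2) \<subseteq> ball (0 :: complex) 1"
      using x by auto
    ultimately show "\<exists>d>0. cball x d \<subseteq> ball 0 1 \<and>
        uniform_limit (cball x d) (\<lambda>N q. \<Prod>j<N. 1 + q ^ Suc j * r c (q ^ Suc j)) (qprod r c) sequentially"
      using sub x by (intro exI[of _ d]) (auto simp: d_def)
  qed (auto)
  show "uniform_limit (ball 0 (1/2)) (\<lambda>N q. \<Prod>j<N. 1 + q ^ Suc j * r c (q ^ Suc j)) (qprod r c) sequentially"
    by (rule uniform_limit_on_subset[OF ul[of "1/2"]]) auto
qed

lemma fprod_tendsto:
  assumes "fprod_convergent F"
  shows "(\<lambda>N. \<Prod>j<N. F j) \<longlonglongrightarrow> fprod F"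
  unfolding tendsto_fps_iff
proof
  fix n
  show "\<forall>\<^sub>F N in sequentially. fps_nth (\<Prod>j<N. F j) n = fps_nth (fprod F) n"
    using eventually_ge_at_top[of n] by eventually_elim (use fprod_nth[OF assms] in auto)
qed

text \<open>The partial products converge uniformly near 0 and their expansions converge formally,
  so the expansion of the limit is the formal product.\<close>

lemma qprod_has_fps_expansion:
  assumes r: "continuous_on UNIV (\<lambda>(c, q). r c q)" and hol: "r c holomorphic_on UNIV"
    and F: "fprod_convergent F" "\<And>j. (\<lambda>q. 1 + q ^ Suc j * r c (q ^ Suc j)) has_fps_expansion F j"
  shows "qprod r c has_fps_expansion fprod F"
proof -
  have exp: "qprod r c has_fps_expansion fps_expansion (qprod r c) 0"
    using holomorphic_qprod(1)[OF assms(1,2)] by (intro has_fps_expansion_fps_expansion[of "ball 0 1"]) auto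
  have "fps_expansion (qprod r c) 0 = fprod F"
  proof (rule uniform_limit_imp_fps_expansion_eq[OF fprod_tendsto[OF F(1)] holomorphic_qprod(2)[OF assms(1,2)] _ exp])
    show "\<forall>\<^sub>F N in sequentially. (\<lambda>q. \<Prod>j<N. 1 + q ^ Suc j * r c (q ^ Suc j)) has_fps_expansion (\<Prod>j<N. F j)"
      by (intro always_eventually allI has_fps_expansion_prod F(2))
    show "\<forall>\<^sub>F N in sequentially. (\<lambda>q. \<Prod>j<N. 1 + q ^ Suc j * r c (q ^ Suc j)) holomorphic_on ball 0 (1/2)"
      by (intro always_eventually allI holomorphic_on_prod holomorphic_qprod(3)[OF assms(1,2)])
  qed auto
  with exp show ?thesis by simp
qed

lemma qprod_nonzero:
  assumes "continuous_on UNIV (\<lambda>(c, q). r c q)" "norm q < 1"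
    and "\<And>y. norm y < 1 \<Longrightarrow> 1 + y * r c y \<noteq> 0"
  shows "qprod r c q \<noteq> 0"
  unfolding qprod_def
proof (rule prodinf_nonzero[OF qprod_convergent[OF assms(1,2)]])
  fix j
  have "norm q * norm q ^ j \<le> norm q * 1"
    using assms(2) by (intro mult_left_mono power_le_one) auto
  hence "norm (q ^ Suc j) < 1"
    unfolding norm_power using assms(2) by simp
  thus "1 + q ^ Suc j * r c (q ^ Suc j) \<noteq> 0" by (rule assms(3))
qed

section \<open>The Euler and theta products as functions of q\<close>

definition euler_fun :: "complex \<Rightarrow> complex" where
  "euler_fun q = prodinf (\<lambda>j. 1 - q ^ Suc j)"

definition theta_fun :: "complex \<Rightarrow> complex \<Rightarrow> complex" where
  "theta_fun c q = prodinf (\<lambda>j. (1 - c * q ^ Suc j + (q ^ Suc j)\<^sup>2) * (1 - q ^ Suc j))"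

lemma euler_fun_qprod: "euler_fun = qprod (\<lambda>_ _. -1) 0"
  by (simp add: fun_eq_iff euler_fun_def qprod_def)

lemma theta_factor: "(1 - c * y + y\<^sup>2) * (1 - y) = 1 + y * (- c - 1 + (c + 1) * y - y\<^sup>2)" for y :: "'a :: comm_ring_1"
  by (simp add: algebra_simps power2_eq_square)

lemma theta_fun_qprod: "theta_fun c = qprod (\<lambda>c y. - c - 1 + (c + 1) * y - y\<^sup>2) c"
  unfolding fun_eq_iff theta_fun_def qprod_def theta_factor by blast

lemma continuous_theta_factor:
  "continuous_on UNIV (\<lambda>(c, y). - c - 1 + (c + 1) * y - y\<^sup>2 :: complex)"
  unfolding case_prod_unfold by (intro continuous_intros)

lemma continuous_euler_factor: "continuous_on UNIV (\<lambda>(c :: complex, y :: complex). -1 :: complex)"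
  unfolding case_prod_unfold by (intro continuous_intros)

lemma holomorphic_euler_fun: "euler_fun holomorphic_on ball 0 1"
  unfolding euler_fun_qprod by (rule holomorphic_qprod(1)[OF continuous_euler_factor]) (auto intro!: holomorphic_intros)

lemma holomorphic_theta_fun: "theta_fun c holomorphic_on ball 0 1"
  unfolding theta_fun_qprod
  by (rule holomorphic_qprod(1)[OF continuous_theta_factor]) (intro holomorphic_intros)

lemma euler_fun_has_fps_expansion: "euler_fun has_fps_expansion euler_fps"
  unfolding euler_fun_qprod euler_fps_def
proof (rule qprod_has_fps_expansion[OF continuous_euler_factor _ fprod_convergent_Euler])
  show "(\<lambda>q::complex. 1 + q ^ Suc j * - 1) has_fps_expansion 1 - fps_X ^ Suc j" for j
    using has_fps_expansion_diff[OF has_fps_expansion_1 has_fps_expansion_fps_X_power[of "Suc j"]]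
    by (simp del: power_Suc)
qed (auto intro!: holomorphic_intros)

lemma fprod_convergent_theta:
  "fprod_convergent (\<lambda>j. (1 - fps_const c * fps_X ^ Suc j + (fps_X ^ Suc j)\<^sup>2) * (1 - fps_X ^ Suc j))"
proof (rule fprod_convergent_mult[OF _ fprod_convergent_Euler])
  have "fps_nth ((fps_X ^ Suc j)\<^sup>2) i = (0 :: 'a)" if "i \<le> j" for i j
    unfolding power_mult [symmetric] by (subst fps_X_power_nth) (use that in auto)
  thus "fprod_convergent (\<lambda>j. 1 - fps_const c * fps_X ^ Suc j + (fps_X ^ Suc j)\<^sup>2)"
    by (auto simp: fprod_convergent_def simp del: power_Suc)
qed

lemma theta_fun_has_fps_expansion: "theta_fun c has_fps_expansion theta_fps c"
  unfolding theta_fun_qprod theta_fps_def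
proof (rule qprod_has_fps_expansion[OF continuous_theta_factor _ fprod_convergent_theta])
  show "(\<lambda>q. 1 + q ^ Suc j * (- c - 1 + (c + 1) * q ^ Suc j - (q ^ Suc j)\<^sup>2)) has_fps_expansion
      (1 - fps_const c * fps_X ^ Suc j + (fps_X ^ Suc j)\<^sup>2) * (1 - fps_X ^ Suc j)" for j
    unfolding theta_factor[symmetric]
    by (intro has_fps_expansion_mult has_fps_expansion_diff has_fps_expansion_add has_fps_expansion_1
        has_fps_expansion_fps_X_power has_fps_expansion_cmult_left has_fps_expansion_power)
qed (intro holomorphic_intros)

lemma euler_fun_nonzero: "norm q < 1 \<Longrightarrow> euler_fun q \<noteq> 0"
  unfolding euler_fun_qprod by (rule qprod_nonzero[OF continuous_euler_factor]) auto

text \<open>For real \<open>a\<close> one has \<open>two_cos d a = w + inverse w\<close> with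
  \<open>norm w = 1\<close>, so each factor splits into linear factors whose zeros lie on the unit
  circle.\<close>

lemma theta_fun_nonzero:
  assumes "norm q < 1"
  shows "theta_fun (two_cos d a) q \<noteq> 0"
  unfolding theta_fun_qprod
proof (rule qprod_nonzero[OF continuous_theta_factor assms])
  fix y :: complex assume y: "norm y < 1"
  define w where "w = exp (2 * of_real pi * \<i> * (of_nat d * of_real a))"
  have w: "norm w = 1" unfolding w_def norm_exp_eq_Re by simp
  hence w0: "w \<noteq> 0" by auto
  have c: "two_cos d a = w + inverse w"
    by (simp add: two_cos_exp w_def exp_minus)
  have "norm (w * y) < 1" "norm (inverse w * y) < 1"
    using y by (simp_all add: norm_mult norm_inverse w)
  hence "1 - w * y \<noteq> 0" "1 - inverse w * y \<noteq> 0" "1 - y \<noteq> 0" using y by auto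
  moreover have "1 - two_cos d a * y + y\<^sup>2 = (1 - w * y) * (1 - inverse w * y)"
    using w0 by (simp add: c algebra_simps power2_eq_square)
  ultimately show "1 + y * (- two_cos d a - 1 + (two_cos d a + 1) * y - y\<^sup>2) \<noteq> 0"
    unfolding theta_factor[symmetric] by simp
qed

lemma continuous_on_euler_fun:
  assumes "continuous_on X q" "q ` X \<subseteq> cball 0 \<rho>" "0 \<le> \<rho>" "\<rho> < 1"
  shows "continuous_on X (\<lambda>x. euler_fun (q x))"
  unfolding euler_fun_qprod
  by (rule continuous_on_qprod[OF continuous_euler_factor _ assms(1), of _ "{0}"]) (use assms in auto)

lemma continuous_on_theta_fun:
  fixes a :: "'a :: t2_space \<Rightarrow> real"
  assumes "continuous_on X a" "continuous_on X q" "q ` X \<subseteq> cball 0 \<rho>" "0 \<le> \<rho>" "\<rho> < 1"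
  shows "continuous_on X (\<lambda>x. theta_fun (two_cos d (a x)) (q x))"
  unfolding theta_fun_qprod
proof (rule continuous_on_qprod[OF continuous_theta_factor _ assms(2), of _ "cball 0 2"])
  show "continuous_on X (\<lambda>x. two_cos d (a x))"
    unfolding two_cos_def by (intro continuous_intros assms)
  show "(\<lambda>x. two_cos d (a x)) ` X \<subseteq> cball 0 2"
    by (auto simp: two_cos_def abs_mult simp del: of_real_mult)
qed (use assms in auto)

text \<open>What is left of \<open>phi\<close> at a real point \<open>a\<close> after removing the
  power of q and the factors that can vanish there.\<close>

definition theta_block :: "int \<Rightarrow> nat \<Rightarrow> (nat \<Rightarrow> nat) \<Rightarrow> real \<Rightarrow> complex \<Rightarrow> complex" where
  "theta_block u l d a q = euler_fun q powi u * (\<Prod>i\<in>{1..l}. theta_fun (two_cos (d i) a) q)"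

definition theta_block_fps :: "int \<Rightarrow> nat \<Rightarrow> (nat \<Rightarrow> nat) \<Rightarrow> real \<Rightarrow> complex fps" where
  "theta_block_fps u l d a = (if u \<ge> 0 then euler_fps ^ nat u else inverse euler_fps ^ nat (- u))
     * (\<Prod>i\<in>{1..l}. theta_fps (two_cos (d i) a))"

lemma holomorphic_theta_block: "theta_block u l d a holomorphic_on ball 0 1"
  unfolding theta_block_def
  by (intro holomorphic_intros holomorphic_euler_fun holomorphic_theta_fun) (auto simp: euler_fun_nonzero)

lemma theta_block_nonzero: "norm q < 1 \<Longrightarrow> theta_block u l d a q \<noteq> 0"
  by (simp add: theta_block_def euler_fun_nonzero theta_fun_nonzero)

lemma continuous_on_theta_block:
  fixes a :: "'a :: t2_space \<Rightarrow> real"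
  assumes "continuous_on X a" "continuous_on X q" "q ` X \<subseteq> cball 0 \<rho>" "0 \<le> \<rho>" "\<rho> < 1"
  shows "continuous_on X (\<lambda>x. theta_block u l d (a x) (q x))"
proof -
  have "norm (q x) < 1" if "x \<in> X" for x
    using assms(3,5) that by (force simp: image_subset_iff)
  thus ?thesis unfolding theta_block_def
    by (intro continuous_intros continuous_on_euler_fun[OF assms(2-5)] continuous_on_theta_fun[OF assms])
       (auto simp: euler_fun_nonzero)
qed

lemma euler_fps_nth_0 [simp]: "fps_nth euler_fps 0 = 1"
  by (simp add: euler_fps_def fprod_nth_0)

lemma theta_block_fps_nth_0: "fps_nth (theta_block_fps u l d a) 0 = 1"
proof -
  have "fps_nth (\<Prod>i\<in>A. theta_fps (two_cos (d i) a)) 0 = 1" for A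
    by (induction A rule: infinite_finite_induct) (simp_all add: theta_fps_def fprod_nth_0)
  thus ?thesis
    by (simp add: theta_block_fps_def fps_power_zeroth_eq_one)
qed

lemma theta_block_has_fps_expansion: "theta_block u l d a has_fps_expansion theta_block_fps u l d a"
proof -
  have "(\<lambda>q. euler_fun q powi u) has_fps_expansion (if u \<ge> 0 then euler_fps ^ nat u else inverse euler_fps ^ nat (- u))"
  proof (cases "u \<ge> 0")
    case True
    thus ?thesis using has_fps_expansion_power[OF euler_fun_has_fps_expansion, of "nat u"]
      by (simp add: power_int_def)
  next
    case False
    thus ?thesis
      using has_fps_expansion_power[OF has_fps_expansion_inverse[OF euler_fun_has_fps_expansion], of "nat (- u)"]
      by (simp add: power_int_def power_inverse)
  qed
  thus ?thesis unfolding theta_block_def theta_block_fps_def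
    by (intro has_fps_expansion_mult has_fps_expansion_prod theta_fun_has_fps_expansion)
qed

text \<open>Each theta factor counts as three Euler products modulo 2, so the total exponent is
  \<open>u + 3 * l = 24 * v\<close>, for either sign of \<open>u\<close>.\<close>

lemma fps_reduces_theta_block:
  assumes "24 * int v = u + 3 * int l"
  shows "fps_reduces (theta_block_fps u l d) (euler2 ^ (24 * v))"
proof -
  define e where "e = (if u \<ge> 0 then euler2 ^ nat u else inverse euler2 ^ nat (- u))"
  have "fps_reduces (\<lambda>_. if u \<ge> 0 then euler_fps ^ nat u else inverse euler_fps ^ nat (- u)) e"
    unfolding e_def using fps_reduces_power[OF fps_reduces_euler] 
      fps_reduces_power[OF fps_reduces_inverse[OF fps_reduces_euler]] by auto
  hence "fps_reduces (theta_block_fps u l d) (e * (\<Prod>i\<in>{1..l}. euler2 ^ 3))"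
    unfolding theta_block_fps_def by (intro fps_reduces_mult fps_reduces_prod fps_reduces_theta)
  also have "e * (\<Prod>i\<in>{1..l}. euler2 ^ 3) = euler2 ^ (24 * v)"
  proof (cases "u \<ge> 0")
    case True
    hence "24 * v = nat u + 3 * l" using assms by linarith
    thus ?thesis using True by (simp add: e_def power_add power_mult)
  next
    case False
    hence "3 * l = nat (- u) + 24 * v" using assms by linarith
    hence "(euler2 ^ 3) ^ l = euler2 ^ nat (- u) * euler2 ^ (24 * v)"
      by (simp add: power_mult [symmetric] power_add)
    moreover have "inverse euler2 * euler2 = 1" by (rule inverse_mult_eq_1) simp
    hence "inverse euler2 ^ nat (- u) * euler2 ^ nat (- u) = 1"
      by (simp flip: power_mult_distrib)
    ultimately show ?thesis using False by (simp add: e_def flip: mult.assoc)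
  qed
  finally show ?thesis .
qed

text \<open>Averaging over both square roots of q removes the odd powers; the two roots will come
  from tau/2 and (tau+1)/2.\<close>

lemma even_part_eval:
  assumes "f holomorphic_on ball 0 1" "f has_fps_expansion F"
  obtains g where "g holomorphic_on ball 0 1" "g has_fps_expansion fps_even_part F"
    "\<And>p. norm p < 1 \<Longrightarrow> g (p\<^sup>2) = (f p + f (-p)) / 2"
proof
  let ?E = "fps_even_part F"
  have sums: "(\<lambda>n. fps_nth ?E n * (p\<^sup>2) ^ n) sums ((f p + f (-p)) / 2)" if p: "norm p < 1" for p
  proof -
    have s: "(\<lambda>n. fps_nth F n * z ^ n) sums f z" if "norm z < 1" for z
      by (rule has_fps_expansion_imp_sums_complex[OF assms(2), of 1]) (use assms(1) that in auto)
    have "(\<lambda>n. (fps_nth F n * p ^ n + fps_nth F n * (-p) ^ n) / 2) sums ((f p + f (-p)) / 2)"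
      by (intro sums_divide sums_add s) (use p in auto)
    moreover have "strict_mono (\<lambda>n::nat. 2 * n)" by (simp add: strict_mono_def)
    moreover have "(fps_nth F n * p ^ n + fps_nth F n * (-p) ^ n) / 2 = 0" if "n \<notin> range (\<lambda>n. 2 * n)" for n
    proof -
      have "odd n" using that by (auto elim: evenE)
      thus ?thesis by simp
    qed
    ultimately have "(\<lambda>n. (fps_nth F (2 * n) * p ^ (2 * n) + fps_nth F (2 * n) * (-p) ^ (2 * n)) / 2) sums ((f p + f (-p)) / 2)"
      by (subst sums_mono_reindex)
    thus ?thesis by (simp add: fps_even_part_def power_mult)
  qed
  have rad: "fps_conv_radius ?E \<ge> 1"
    unfolding fps_conv_radius_def
  proof (rule conv_radius_geI_ex)
    fix r :: real assume r: "0 < r" "ereal r < 1"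
    \<comment> \<open>Convergence at the point \<open>r\<close> follows from \<open>sums\<close> at
      its square root, which gives convergence radius at least 1.\<close>
    have "norm (of_real (sqrt r) :: complex) < 1" using r by simp
    from sums[OF this] show "\<exists>z. norm z = r \<and> summable (\<lambda>n. fps_nth ?E n * z ^ n)"
      using r by (intro exI[of _ "of_real r"]) (auto simp: sums_iff simp flip: of_real_power)
  qed
  show "eval_fps ?E holomorphic_on ball 0 1"
    by (rule holomorphic_on_subset[OF holomorphic_on_eval_fps[OF order_refl]])
       (auto intro!: less_le_trans[OF _ rad])
  show "eval_fps ?E has_fps_expansion ?E"
    by (rule eval_fps_has_fps_expansion) (use rad in \<open>auto intro: less_le_trans[of 0 1]\<close>)
  fix p :: complex assume p: "norm p < 1"
  have "norm (p\<^sup>2) < 1" using p by (simp add: norm_power power_less_one_iff abs_square_less_1)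
  hence "ereal (norm (p\<^sup>2)) < fps_conv_radius ?E"
    using rad by (intro less_le_trans[OF _ rad]) simp
  from sums_eval_fps[OF this] sums[OF p] show "eval_fps ?E (p\<^sup>2) = (f p + f (-p)) / 2"
    by (rule sums_unique2)
qed

section \<open>Fourier integrals as Cauchy integrals\<close>

definition nome :: "real \<Rightarrow> complex" where
  "nome x = qq (of_real x + \<i>)"

lemma nome_polar: "nome x = of_real (exp (- 2 * pi)) * exp (2 * of_real pi * \<i> * of_real x)"
proof -
  have "nome x = exp (of_real (- 2 * pi) + 2 * of_real pi * \<i> * of_real x)"
    unfolding nome_def qq_def by (rule arg_cong[of _ _ exp]) (simp add: algebra_simps)
  thus ?thesis by (simp only: exp_add exp_of_real)
qed

text \<open>On Im tau = 1 the variable q runs once around the circle of radius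
  \<open>exp (- 2 * pi)\<close>, so this is Cauchy's formula for the derivatives at 0.\<close>

lemma Cauchy_coefficient_nat:
  assumes "f holomorphic_on ball 0 1" "f has_fps_expansion F"
  shows "((\<lambda>x. f (nome x) / nome x ^ m) has_integral fps_nth F m) {0..1}"
proof -
  define r where "r = exp (- 2 * pi)"
  have r: "0 < r" "r < 1" by (simp_all add: r_def)
  have nome: "circlepath 0 r = nome"
    unfolding circlepath fun_eq_iff nome_polar r_def by simp
  have nz: "nome x \<noteq> 0" for x by (simp add: nome_def qq_def)
  have "((\<lambda>u. f u / (u - 0) ^ Suc m) has_contour_integral (2 * pi * \<i> / fact m * (deriv ^^ m) f 0)) (circlepath 0 r)"
  proof (rule Cauchy_has_contour_integral_higher_derivative_circlepath)
    show "continuous_on (cball 0 r) f"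
      using assms(1) r by (intro holomorphic_on_imp_continuous_on holomorphic_on_subset[OF assms(1)]) auto
    show "f holomorphic_on ball 0 r"
      using r by (intro holomorphic_on_subset[OF assms(1)]) auto
  qed (use r in auto)
  hence "((\<lambda>x. f (nome x) / nome x ^ Suc m * vector_derivative (circlepath 0 r) (at x within {0..1}))
      has_integral (2 * pi * \<i> / fact m * (deriv ^^ m) f 0)) {0..1}"
    unfolding has_contour_integral_def nome by simp
  \<comment> \<open>The velocity of the circle is \<open>2 * pi * \<i> * nome x\<close>, which turns
    the exponent \<open>Suc m\<close> into \<open>m\<close>.\<close>
  also have "?this \<longleftrightarrow> ((\<lambda>x. 2 * pi * \<i> * (f (nome x) / nome x ^ m)) has_integral (2 * pi * \<i> / fact m * (deriv ^^ m) f 0)) {0..1}"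
  proof (rule has_integral_cong)
    fix x :: real assume "x \<in> {0..1}"
    hence "vector_derivative (circlepath 0 r) (at x within {0..1}) = 2 * pi * \<i> * nome x"
      by (subst vector_derivative_circlepath01) (auto simp: nome_polar r_def)
    thus "f (nome x) / nome x ^ Suc m * vector_derivative (circlepath 0 r) (at x within {0..1})
        = 2 * pi * \<i> * (f (nome x) / nome x ^ m)"
      using nz[of x] by simp
  qed
  finally have "((\<lambda>x. 1 / (2 * pi * \<i>) * (2 * pi * \<i> * (f (nome x) / nome x ^ m)))
      has_integral (1 / (2 * pi * \<i>) * (2 * pi * \<i> / fact m * (deriv ^^ m) f 0))) {0..1}"
    by (rule has_integral_mult_right)
  thus ?thesis
    by (simp add: fps_nth_fps_expansion[OF assms(2)])
qed

lemma Cauchy_coefficient: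
  assumes "f holomorphic_on ball 0 1" "f has_fps_expansion F"
  shows "((\<lambda>x. f (nome x) * nome x powi (- m)) has_integral (if m \<ge> 0 then fps_nth F (nat m) else 0)) {0..1}"
proof (cases "m \<ge> 0")
  case True
  hence "nome x powi (- m) = inverse (nome x ^ nat m)" for x
    by (subst power_int_minus) (simp add: power_int_def)
  thus ?thesis using True Cauchy_coefficient_nat[OF assms, of "nat m"]
    by (simp add: field_simps)
next
  case False
  \<comment> \<open>For negative \<open>m\<close> the factor \<open>q ^ k\<close> with
    \<open>k > 0\<close> is absorbed into the function, whose constant coefficient is then
    0.\<close>
  define k where "k = nat (- m)"
  have k: "k > 0" "- m = int k" using False by (auto simp: k_def)
  have "(\<lambda>q. f q * q ^ k) holomorphic_on ball 0 1"
    by (intro holomorphic_intros assms)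
  moreover have "(\<lambda>q. f q * q ^ k) has_fps_expansion F * fps_X ^ k"
    by (intro has_fps_expansion_mult assms has_fps_expansion_fps_X_power)
  ultimately have "((\<lambda>x. f (nome x) * nome x ^ k / nome x ^ 0) has_integral fps_nth (F * fps_X ^ k) 0) {0..1}"
    by (rule Cauchy_coefficient_nat)
  thus ?thesis using k False by (simp add: k(2))
qed

subsection \<open>The Fourier coefficients\<close>

definition sin_prod :: "nat \<Rightarrow> (nat \<Rightarrow> nat) \<Rightarrow> real \<Rightarrow> complex" where
  "sin_prod l d a = (\<Prod>i\<in>{1..l}. exp (of_real pi * \<i> * (of_nat (d i) * of_real a)) - exp (- (of_real pi * \<i> * (of_nat (d i) * of_real a))))"

definition cos_prod :: "nat \<Rightarrow> (nat \<Rightarrow> nat) \<Rightarrow> real \<Rightarrow> complex" where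
  "cos_prod l d a = (\<Prod>i\<in>{1..l}. exp (of_real pi * \<i> * (of_nat (d i) * of_real a)) + exp (- (of_real pi * \<i> * (of_nat (d i) * of_real a))))"

lemma sin_prod_double: "sin_prod l d (2 * a) = sin_prod l d a * cos_prod l d a"
proof -
  have "exp (of_real pi * \<i> * (of_nat n * of_real (2 * a))) - exp (- (of_real pi * \<i> * (of_nat n * of_real (2 * a))))
     = (exp (of_real pi * \<i> * (of_nat n * of_real a)) - exp (- (of_real pi * \<i> * (of_nat n * of_real a))))
       * (exp (of_real pi * \<i> * (of_nat n * of_real a)) + exp (- (of_real pi * \<i> * (of_nat n * of_real a))))" for n
    by (simp add: algebra_simps flip: exp_add)
  thus ?thesis by (simp add: sin_prod_def cos_prod_def prod.distrib)
qed

text \<open>Zeros are fractions with denominator some \<open>d i\<close>. At these points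
  \<open>psi\<close> divides by zero; finiteness makes them negligible for the integral.\<close>

lemma finite_sin_prod_zeros:
  assumes "\<forall>i\<in>{1..l}. d i > 0"
  shows "finite {a\<in>{0..1}. sin_prod l d a = 0}"
proof (rule finite_subset)
  show "{a\<in>{0..1}. sin_prod l d a = 0} \<subseteq> (\<Union>i\<in>{1..l}. (\<lambda>m. of_int m / of_nat (d i)) ` {0..int (d i)})"
  proof
    fix a assume "a \<in> {a\<in>{0..1}. sin_prod l d a = 0}"
    then obtain i where a: "0 \<le> a" "a \<le> 1" and i: "i \<in> {1..l}"
      and eq: "exp (of_real pi * \<i> * (of_nat (d i) * of_real a)) = exp (- (of_real pi * \<i> * (of_nat (d i) * of_real a)))"
      by (auto simp: sin_prod_def)
    have d: "d i > 0" using assms i by blast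
    from eq obtain n :: int where "Im (of_real pi * \<i> * (of_nat (d i) * of_real a))
        = Im (- (of_real pi * \<i> * (of_nat (d i) * of_real a))) + of_int (2 * n) * pi"
      unfolding exp_eq by (auto simp: complex_eq_iff)
    hence "pi * (of_nat (d i) * a) = pi * of_int n" by (simp add: mult.commute)
    hence n: "of_nat (d i) * a = of_int n" by (simp only: mult_cancel_left pi_neq_zero simp_thms)
    hence "a = of_int n / of_nat (d i)" using d by (simp add: field_simps)
    moreover have "0 \<le> real_of_int n" "real_of_int n \<le> of_nat (d i) * 1"
      unfolding n[symmetric] using a by (auto intro!: mult_left_mono simp del: mult_1_right)
    hence "n \<in> {0..int (d i)}" by auto
    ultimately show "a \<in> (\<Union>i\<in>{1..l}. (\<lambda>m. of_int m / of_nat (d i)) ` {0..int (d i)})"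
      using i by blast
  qed
qed auto

lemma jtheta_real:
  "jtheta \<tau> (of_nat n * of_real a) = exp (2 * of_real pi * \<i> * \<tau> / 8)
     * (exp (of_real pi * \<i> * (of_nat n * of_real a)) - exp (- (of_real pi * \<i> * (of_nat n * of_real a))))
     * theta_fun (two_cos n a) (qq \<tau>)"
proof -
  define w where "w = qq (of_nat n * of_real a)"
  have w: "w \<noteq> 0" "two_cos n a = w + inverse w"
    by (simp_all add: w_def qq_def two_cos_exp exp_minus)
  have eq: "(1 - y * w) * (1 - y / w) * (1 - y) = (1 - two_cos n a * y + y\<^sup>2) * (1 - y)" for y
    unfolding w(2) using w(1) by (simp add: field_simps power2_eq_square)
  show ?thesis
    by (simp only: jtheta_def theta_fun_def w_def[symmetric] eq)
qed

lemma phi_real: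
  assumes "24 * int v = u + 3 * int l"
  shows "phi u l d \<tau> (of_real a) = qq \<tau> ^ v * sin_prod l d a * theta_block u l d a (qq \<tau>)"
proof -
  \<comment> \<open>A 24th root of q: \<open>eta\<close> and the theta functions contribute the
    powers \<open>u\<close> and \<open>3 * l\<close> of it, which together give
    \<open>qq \<tau> ^ v\<close>.\<close>
  define A where "A = exp (2 * of_real pi * \<i> * \<tau> / 24)"
  have A: "A \<noteq> 0" by (simp add: A_def)
  have B: "exp (2 * of_real pi * \<i> * \<tau> / 8) = A ^ 3"
    unfolding A_def exp_of_nat_mult[symmetric] by (rule arg_cong[of _ _ exp]) simp
  have Q: "qq \<tau> = A ^ 24"
    unfolding A_def qq_def exp_of_nat_mult[symmetric] by (rule arg_cong[of _ _ exp]) simp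
  have eta: "eta \<tau> = A * euler_fun (qq \<tau>)"
    by (simp add: eta_def A_def euler_fun_def)
  have "A powi u * (A ^ 3) ^ l = A powi u * A powi int (3 * l)"
    by (simp only: power_int_of_nat power_mult)
  also have "\<dots> = A powi (u + int (3 * l))"
    using A by (subst power_int_add) auto
  also have "u + int (3 * l) = int (24 * v)"
    using assms by simp
  also have "A powi int (24 * v) = qq \<tau> ^ v"
    by (simp only: power_int_of_nat power_mult Q)
  finally have "A powi u * (A ^ 3) ^ l = qq \<tau> ^ v" .
  thus ?thesis
    unfolding phi_def jtheta_real eta B theta_block_def sin_prod_def
    by (simp add: power_int_mult_distrib prod.distrib mult_ac)
qed

definition half_nome :: "real \<Rightarrow> complex" where
  "half_nome x = qq ((of_real x + \<i>) / 2)"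

lemma half_nome_square: "(half_nome x)\<^sup>2 = nome x"
  unfolding half_nome_def nome_def qq_def exp_of_nat_mult[symmetric]
  by (rule arg_cong[of _ _ exp]) simp

lemma nome_double: "qq (2 * (of_real x + \<i>)) = (nome x)\<^sup>2"
  unfolding nome_def qq_def exp_of_nat_mult[symmetric]
  by (rule arg_cong[of _ _ exp]) simp

lemma half_nome_shift: "qq ((of_real x + \<i> + 1) / 2) = - half_nome x"
proof -
  have "qq ((of_real x + \<i> + 1) / 2) = exp (2 * of_real pi * \<i> * ((of_real x + \<i>) / 2) + of_real pi * \<i>)"
    unfolding qq_def by (rule arg_cong[of _ _ exp]) (simp add: field_simps)
  thus ?thesis by (simp add: exp_add half_nome_def qq_def)
qed

lemma norm_nome: "norm (nome x) = exp (- 2 * pi)" and norm_half_nome: "norm (half_nome x) = exp (- pi)"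
  by (simp_all add: nome_def half_nome_def qq_def)

lemma nome_nonzero [simp]: "nome x \<noteq> 0"
  by (simp add: nome_def qq_def)

lemma norm_nome_less: "norm (nome x) < 1" and norm_half_nome_less: "norm (half_nome x) < 1"
  by (simp_all add: norm_nome norm_half_nome)

lemma continuous_on_nome:
  fixes f :: "'a :: t2_space \<Rightarrow> real"
  shows "continuous_on X f \<Longrightarrow> continuous_on X (\<lambda>x. nome (f x))"
  and continuous_on_half_nome: "continuous_on X f \<Longrightarrow> continuous_on X (\<lambda>x. half_nome (f x))"
  unfolding nome_def half_nome_def qq_def by (intro continuous_intros; simp)+

text \<open>\<open>psi\<close> with \<open>sin_prod\<close> cancelled, hence continuous across its
  zeros. The first summand has no pole in q, since its factor q^(2v) outweighs the denominator q^v;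
  only the second can have one, of order at most \<open>v\<close>.\<close>

definition psi_reg :: "int \<Rightarrow> int \<Rightarrow> nat \<Rightarrow> nat \<Rightarrow> (nat \<Rightarrow> nat) \<Rightarrow> real \<Rightarrow> real \<Rightarrow> complex" where
  "psi_reg k u v l d x a = (-1) ^ v *
     (2 powi (k - 1) * cos_prod l d a * (nome x ^ v * theta_block u l d (2 * a) ((nome x)\<^sup>2) / theta_block u l d a (nome x))
      + (half_nome x ^ v * theta_block u l d a (half_nome x) + (- half_nome x) ^ v * theta_block u l d a (- half_nome x)) / 2
        / theta_block u l d a (nome x) * nome x powi (- int v))"

lemma psi_eq_psi_reg:
  assumes v: "24 * int v = u + 3 * int l" and nz: "sin_prod l d a \<noteq> 0"
  shows "psi k u v l d (of_real x + \<i>) (of_real a) = psi_reg k u v l d x a"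
proof -
  let ?\<tau> = "of_real x + \<i>" and ?B = "theta_block u l d"
  have "2 * of_real a = (of_real (2 * a) :: complex)" by simp
  hence 1: "phi u l d (2 * ?\<tau>) (2 * of_real a) = (nome x)\<^sup>2 ^ v * (sin_prod l d a * cos_prod l d a) * ?B (2 * a) ((nome x)\<^sup>2)"
    by (simp only: phi_real[OF v] nome_double sin_prod_double)
  have 2: "phi u l d (?\<tau> / 2) (of_real a) = half_nome x ^ v * sin_prod l d a * ?B a (half_nome x)"
    by (simp only: phi_real[OF v] half_nome_def)
  have 3: "phi u l d ((?\<tau> + 1) / 2) (of_real a) = (- half_nome x) ^ v * sin_prod l d a * ?B a (- half_nome x)"
    by (simp only: phi_real[OF v] half_nome_shift)
  have 4: "phi u l d ?\<tau> (of_real a) = nome x ^ v * sin_prod l d a * ?B a (nome x)"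
    by (simp only: phi_real[OF v] nome_def)
  have alg: "s * (c * (q\<^sup>2 ^ v * (S * C) * t2) + 1 / 2 * (p ^ v * S * tp + p' ^ v * S * tm)) / (q ^ v * S * t)
      = s * (c * C * (q ^ v * t2 / t) + (p ^ v * tp + p' ^ v * tm) / 2 / t * inverse (q ^ v))"
    if "q \<noteq> 0" "S \<noteq> 0" "t \<noteq> 0" for s c q C t2 p tp p' tm S t :: complex
  proof -
    have "q\<^sup>2 ^ v = q ^ v * q ^ v" by (simp add: power2_eq_square power_mult_distrib)
    thus ?thesis using that by (simp add: field_simps)
  qed
  have B: "?B a (nome x) \<noteq> 0" by (rule theta_block_nonzero[OF norm_nome_less])
  show ?thesis
    unfolding psi_def V2_def 1 2 3 4 psi_reg_def power_int_minus power_int_of_nat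
    by (rule alg[OF nome_nonzero nz B])
qed

lemma continuous_on_psi_reg: "continuous_on X (\<lambda>(x, a). psi_reg k u v l d x a * nome x powi m)"
proof -
  \<comment> \<open>The radius \<open>exp (- pi)\<close> is the modulus of \<open>half_nome\<close>,
    the largest among the four arguments.\<close>
  have n: "(nome (fst z))\<^sup>2 \<in> cball 0 (exp (- pi))" "nome (fst z) \<in> cball 0 (exp (- pi))"
    "half_nome (fst z) \<in> cball 0 (exp (- pi))" "- half_nome (fst z) \<in> cball 0 (exp (- pi))" for z :: "real \<times> real"
    by (auto simp: norm_nome norm_half_nome norm_power simp flip: exp_of_nat_mult)
  have B: "continuous_on X (\<lambda>z :: real \<times> real. theta_block u l d (a z) (q z))"
    if "continuous_on X a" "continuous_on X q" "\<And>z. q z \<in> cball 0 (exp (- pi))" for a q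
    by (rule continuous_on_theta_block[OF that(1,2), of "exp (- pi)"]) (use that(3) in auto)
  have nome: "continuous_on X (\<lambda>z. nome (fst z))" "continuous_on X (\<lambda>z. half_nome (fst z))"
    by (intro continuous_on_nome continuous_on_half_nome continuous_intros)+
  have cos: "continuous_on X (\<lambda>z. cos_prod l d (snd z))"
    unfolding cos_prod_def by (intro continuous_intros)
  have B1: "continuous_on X (\<lambda>z. theta_block u l d (2 * snd z) ((nome (fst z))\<^sup>2))"
    by (rule B[OF _ _ n(1)]) (intro continuous_intros nome)+
  have B2: "continuous_on X (\<lambda>z. theta_block u l d (snd z) (nome (fst z)))"
    by (rule B[OF _ _ n(2)]) (intro continuous_intros nome)+
  have B3: "continuous_on X (\<lambda>z. theta_block u l d (snd z) (half_nome (fst z)))"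
    by (rule B[OF _ _ n(3)]) (intro continuous_intros nome)+
  have B4: "continuous_on X (\<lambda>z. theta_block u l d (snd z) (- half_nome (fst z)))"
    by (rule B[OF _ _ n(4)]) (intro continuous_intros nome)+
  have nz: "theta_block u l d (snd z) (nome (fst z)) \<noteq> 0" for z :: "real \<times> real"
    by (rule theta_block_nonzero[OF norm_nome_less])
  show ?thesis
    unfolding psi_reg_def case_prod_unfold
    by (intro continuous_intros nome cos B1 B2 B3 B4) (simp_all add: nz)
qed

text \<open>For negative \<open>n\<close> the part from \<open>\<phi>(2\<tau>, 2z)\<close> drops
  out, being holomorphic in q at 0. The other part is q^(-v) times a power series, hence the shift
  of the index by \<open>v\<close>.\<close>

lemma psi_reg_coefficient:
  fixes k u n :: int and v l :: nat and d :: "nat \<Rightarrow> nat"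
  assumes "n < 0"
  defines "F \<equiv> (\<lambda>a. fps_even_part (fps_X ^ v * theta_block_fps u l d a) * inverse (theta_block_fps u l d a))"
  shows "((\<lambda>x. psi_reg k u v l d x a * nome x powi (- n)) has_integral
      (-1) ^ v * (if int v + n \<ge> 0 then fps_nth (F a) (nat (int v + n)) else 0)) {0..1}"
proof -
  let ?B = "theta_block u l d"
  have holB: "?B a holomorphic_on ball 0 1" for a by (rule holomorphic_theta_block)
  have expB: "?B a has_fps_expansion theta_block_fps u l d a" for a by (rule theta_block_has_fps_expansion)
  have nzB: "norm q < 1 \<Longrightarrow> ?B a q \<noteq> 0" for a q by (rule theta_block_nonzero)
  obtain g where g: "g holomorphic_on ball 0 1" "g has_fps_expansion fps_even_part (fps_X ^ v * theta_block_fps u l d a)"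
    "\<And>p. norm p < 1 \<Longrightarrow> g (p\<^sup>2) = (p ^ v * ?B a p + (-p) ^ v * ?B a (-p)) / 2"
  proof (rule even_part_eval)
    show "(\<lambda>p. p ^ v * ?B a p) holomorphic_on ball 0 1" by (intro holomorphic_intros holB)
    show "(\<lambda>p. p ^ v * ?B a p) has_fps_expansion fps_X ^ v * theta_block_fps u l d a"
      by (intro has_fps_expansion_mult expB has_fps_expansion_fps_X_power)
  qed blast
  define f1 where "f1 = (\<lambda>q. q ^ v * ?B (2 * a) (q\<^sup>2) / ?B a q)"
  define f2 where "f2 = (\<lambda>q. g q * inverse (?B a q))"
  have hol1: "f1 holomorphic_on ball 0 1"
  proof -
    have "(?B (2 * a) \<circ> (\<lambda>q. q\<^sup>2)) holomorphic_on ball 0 1"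
      by (rule holomorphic_on_compose_gen[OF _ holB]) (auto intro!: holomorphic_intros simp: norm_power abs_square_less_1)
    thus ?thesis unfolding f1_def o_def by (intro holomorphic_intros holB) (auto simp: nzB)
  qed
  have "((\<lambda>x. f1 (nome x) * nome x powi (- n)) has_integral (if n \<ge> 0 then fps_nth (fps_expansion f1 0) (nat n) else 0)) {0..1}"
    using hol1 by (intro Cauchy_coefficient has_fps_expansion_fps_expansion[of "ball 0 1"]) auto
  hence 1: "((\<lambda>x. f1 (nome x) * nome x powi (- n)) has_integral 0) {0..1}"
    using assms by simp
  have 2: "((\<lambda>x. f2 (nome x) * nome x powi (- (int v + n))) has_integral
      (if int v + n \<ge> 0 then fps_nth (F a) (nat (int v + n)) else 0)) {0..1}"
  proof (rule Cauchy_coefficient)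
    show "f2 holomorphic_on ball 0 1" unfolding f2_def by (intro holomorphic_intros g holB) (auto simp: nzB)
    show "f2 has_fps_expansion F a" unfolding f2_def F_def
      by (intro has_fps_expansion_mult g has_fps_expansion_inverse expB) (simp add: theta_block_fps_nth_0)
  qed
  have "((\<lambda>x. (-1) ^ v * (2 powi (k - 1) * cos_prod l d a * (f1 (nome x) * nome x powi (- n))
        + f2 (nome x) * nome x powi (- (int v + n))))
      has_integral ((-1) ^ v * (2 powi (k - 1) * cos_prod l d a * 0
        + (if int v + n \<ge> 0 then fps_nth (F a) (nat (int v + n)) else 0)))) {0..1}"
    by (intro has_integral_mult_right has_integral_add 1 2)
  also have "(\<lambda>x. (-1) ^ v * (2 powi (k - 1) * cos_prod l d a * (f1 (nome x) * nome x powi (- n))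
        + f2 (nome x) * nome x powi (- (int v + n)))) = (\<lambda>x. psi_reg k u v l d x a * nome x powi (- n))"
  proof
    fix x
    have "f2 (nome x) = (half_nome x ^ v * ?B a (half_nome x) + (- half_nome x) ^ v * ?B a (- half_nome x)) / 2 / ?B a (nome x)"
      using g(3)[OF norm_half_nome_less, of x] unfolding half_nome_square f2_def
      by (simp only: divide_inverse[of _ "?B a (nome x)"])
    moreover have "nome x powi (- (int v + n)) = nome x powi (- int v) * nome x powi (- n)"
      by (simp flip: power_int_add)
    ultimately show "(-1) ^ v * (2 powi (k - 1) * cos_prod l d a * (f1 (nome x) * nome x powi (- n))
        + f2 (nome x) * nome x powi (- (int v + n))) = psi_reg k u v l d x a * nome x powi (- n)"
      by (simp only: psi_reg_def f1_def distrib_right mult.assoc)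
  qed
  finally show ?thesis by simp
qed

text \<open>After the integrals are exchanged, the inner one picks a power of q and the outer one
  the constant term in zeta. Below \<open>-v\<close> the integer \<open>m\<close> is exactly 0, not
  merely even, which makes the sum over \<open>n\<close> finite.\<close>

lemma fourier_coeff_psi:
  assumes v: "24 * int v = u + 3 * int l" and d: "\<forall>i\<in>{1..l}. d i > 0" and n: "n < 0"
  obtains m :: int where "fourier_coeff (psi k u v l d) n 0 = (-1) ^ v * of_int m"
    "of_int m = (if int v + n \<ge> 0
       then fps_nth (fps_even_part (delta2 ^ v) * inverse (euler2 ^ (24 * v))) (nat (int v + n)) else 0)"
    "int v + n < 0 \<Longrightarrow> m = 0"
proof -
  define F where "F = (\<lambda>a. fps_even_part (fps_X ^ v * theta_block_fps u l d a) * inverse (theta_block_fps u l d a))"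
  define H where "H = fps_even_part (delta2 ^ v) * inverse (euler2 ^ (24 * v))"
  define c where "c = (\<lambda>a. if int v + n \<ge> 0 then fps_nth (F a) (nat (int v + n)) else 0)"
  have delta: "delta2 ^ v = fps_X ^ v * euler2 ^ (24 * v)"
    by (simp add: delta2_def power_mult_distrib power_mult)
  have "fps_reduces F H"
    unfolding F_def H_def delta
    by (intro fps_reduces_mult fps_reduces_even_part fps_reduces_inverse fps_reduces_X_power fps_reduces_theta_block[OF v])
       (simp_all add: theta_block_fps_nth_0 fps_power_zeroth_eq_one)
  hence "cos_poly c (if int v + n \<ge> 0 then fps_nth H (nat (int v + n)) else 0)"
    by (simp add: c_def fps_reduces_def cos_poly_0)
  then obtain m :: int where m: "(c has_integral of_int m) {0..1}"
    "of_int m = (if int v + n \<ge> 0 then fps_nth H (nat (int v + n)) else 0)"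
    by (rule cos_poly_integral)
  have "fourier_coeff (psi k u v l d) n 0 = integral {0..1} (\<lambda>x. integral {0..1} (\<lambda>a. psi_reg k u v l d x a * nome x powi (- n)))"
    unfolding fourier_coeff_def
  \<comment> \<open>\<open>psi\<close> and \<open>psi_reg\<close> agree off the finitely many zeros
    of \<open>sin_prod\<close>, which do not affect the inner integral.\<close>
  proof (rule integral_cong, rule integral_spike[OF negligible_finite[OF finite_sin_prod_zeros[OF d]]])
    fix x a :: real
    assume "a \<in> {0..1} - {a\<in>{0..1}. sin_prod l d a = 0}"
    hence nz: "sin_prod l d a \<noteq> 0" by auto
    have "exp (- 2 * of_real pi * \<i> * (of_int n * (of_real x + \<i>) + of_int 0 * of_real a)) = nome x powi (- n)"
      unfolding nome_def qq_def exp_power_int by (rule arg_cong[of _ _ exp]) simp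
    thus "psi_reg k u v l d x a * nome x powi (- n) = psi k u v l d (of_real x + \<i>) (of_real a) *
        exp (- 2 * of_real pi * \<i> * (of_int n * (of_real x + \<i>) + of_int 0 * of_real a))"
      by (simp only: psi_eq_psi_reg[OF v nz])
  qed
  also have "\<dots> = integral {0..1} (\<lambda>a. integral {0..1} (\<lambda>x. psi_reg k u v l d x a * nome x powi (- n)))"
    using integral_swap_continuous[OF continuous_on_psi_reg, of 0 1 0 1] by simp
  also have "\<dots> = integral {0..1} (\<lambda>a. (-1) ^ v * c a)"
    unfolding c_def F_def using psi_reg_coefficient[OF n] by (intro integral_cong integral_unique) auto
  also have "\<dots> = (-1) ^ v * of_int m"
    by (intro integral_unique has_integral_mult_right m)
  finally have "fourier_coeff (psi k u v l d) n 0 = (-1) ^ v * of_int m" .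
  moreover have "m = 0" if "int v + n < 0"
  proof -
    have "(c has_integral 0) {0..1}" using that by (simp add: c_def)
    thus ?thesis using has_integral_unique[OF m(1)] by force
  qed
  ultimately show ?thesis using m(2) that unfolding H_def by blast
qed

section \<open>The parity of D_0\<close>

lemma bit_of_int_eq_1_iff: "(of_int m :: bit) = 1 \<longleftrightarrow> odd m"
proof (cases "even m")
  case True
  then obtain j where "m = 2 * j" by (elim evenE)
  thus ?thesis by simp
next
  case False
  then obtain j where "m = 2 * j + 1" by (elim oddE)
  thus ?thesis by simp
qed

theorem theorem7p1:
  fixes k u :: int and v l t :: nat and d :: "nat \<Rightarrow> nat"
  assumes "2 * k = int l + u"
    and "2 * t = (\<Sum>i\<in>{1..l}. (d i)^2)"
    and "24 * int v = u + 3 * int l"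
    and "\<forall>i\<in>{1..l}. d i > 0"
  shows "(\<exists>m::int. (\<Sum>\<^sub>\<infinity>n\<in>{n::int. n < 0}.
              of_nat (sigma0 (nat (- n))) * fourier_coeff (psi k u v l d) n 0) = of_int (2 * m + 1))
         \<longleftrightarrow> (\<exists>\<beta>::nat. odd \<beta> \<and> v = 2 ^ \<beta>)"
proof -
  define H where "H = fps_even_part (delta2 ^ v) * inverse (euler2 ^ (24 * v))"
  have "\<exists>m::int. n < 0 \<longrightarrow> fourier_coeff (psi k u v l d) n 0 = (-1) ^ v * of_int m \<and>
      of_int m = (if int v + n \<ge> 0 then fps_nth H (nat (int v + n)) else 0) \<and> (int v + n < 0 \<longrightarrow> m = 0)" for n
    using fourier_coeff_psi[OF assms(3,4), of n k] unfolding H_def by metis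
  then obtain c :: "int \<Rightarrow> int" where c: "\<And>n. n < 0 \<Longrightarrow> fourier_coeff (psi k u v l d) n 0 = (-1) ^ v * of_int (c n)"
      "\<And>n. n < 0 \<Longrightarrow> of_int (c n) = (if int v + n \<ge> 0 then fps_nth H (nat (int v + n)) else 0)"
      "\<And>n. n < 0 \<Longrightarrow> int v + n < 0 \<Longrightarrow> c n = 0"
    by metis
  define N where "N = (-1) ^ v * (\<Sum>m=1..v. int (sigma0 m) * c (- int m))"
  have "(\<Sum>\<^sub>\<infinity>n\<in>{n::int. n < 0}. of_nat (sigma0 (nat (- n))) * fourier_coeff (psi k u v l d) n 0)
      = (\<Sum>\<^sub>\<infinity>n\<in>{- int v..-1}. of_nat (sigma0 (nat (- n))) * ((-1) ^ v * of_int (c n)))"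
    \<comment> \<open>Terms with \<open>n < - v\<close> vanish because \<open>c n\<close> is 0
      there, which reduces the infinite sum to a finite one.\<close>
    using c(1,3) by (intro infsum_cong_neutral) auto
  also have "\<dots> = (\<Sum>n\<in>{- int v..-1}. of_nat (sigma0 (nat (- n))) * ((-1) ^ v * of_int (c n)))"
    by (rule infsum_finite) simp
  also have "\<dots> = (\<Sum>m=1..v. of_nat (sigma0 m) * ((-1) ^ v * of_int (c (- int m))))"
    by (rule sum.reindex_bij_witness[of _ "\<lambda>m. - int m" "\<lambda>n. nat (- n)"]) auto
  also have "\<dots> = of_int N"
    by (simp add: N_def sum_distrib_left mult_ac)
  finally have D: "(\<Sum>\<^sub>\<infinity>n\<in>{n::int. n < 0}. of_nat (sigma0 (nat (- n))) * fourier_coeff (psi k u v l d) n 0) = of_int N" .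
  have "(of_int N :: bit) = of_int ((-1) ^ v) * (\<Sum>m=1..v. of_nat (sigma0 m) * of_int (c (- int m)))"
    by (simp only: N_def of_int_mult of_int_sum of_int_of_nat_eq)
  \<comment> \<open>The sign in the definition of \<open>psi\<close> is odd and disappears modulo
    2.\<close>
  also have "(of_int ((-1) ^ v) :: bit) = 1"
    by (simp only: bit_of_int_eq_1_iff) simp
  also have "(\<Sum>m=1..v. of_nat (sigma0 m) * of_int (c (- int m)))
      = (\<Sum>m=1..v. of_nat (sigma0 m) * fps_nth H (v - m))"
  proof (rule sum.cong)
    fix m assume m: "m \<in> {1..v}"
    hence "nat (int v + - int m) = v - m" by auto
    with m c(2)[of "- int m"] have "(of_int (c (- int m)) :: bit) = fps_nth H (v - m)" by simp
    thus "of_nat (sigma0 m) * of_int (c (- int m)) = of_nat (sigma0 m) * fps_nth H (v - m)" by (simp only:)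
  qed simp
  also have "\<dots> = (if \<exists>\<beta>. odd \<beta> \<and> v = 2 ^ \<beta> then 1 else 0)"
    unfolding H_def by (rule principal_part_parity)
  finally have "odd N \<longleftrightarrow> (\<exists>\<beta>. odd \<beta> \<and> v = 2 ^ \<beta>)"
    unfolding bit_of_int_eq_1_iff[symmetric] by (simp split: if_splits)
  moreover have "(\<exists>m::int. (of_int N :: complex) = of_int (2 * m + 1)) \<longleftrightarrow> odd N"
    unfolding of_int_eq_iff by (auto elim: oddE)
  ultimately show ?thesis unfolding D by simp
qed

end
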